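(* Let $d\ge2$, let $C\in\mathcal{C}_{ar}^d$ be a $d$-dimensional Archimedean copula and let $\gamma\in\mathcal{P}_{\mathcal{W}_d}$ be its corresponding Williamson measure, with Lebesgue decomposition $\gamma=\gamma^{abs}+\gamma^{dis}+\gamma^{sing}$. Then the following assertions hold: (i) If $\gamma^{abs}$ has full support $[0,\infty)$, then $\mu_C^{abs}$ has full support $\mathbb{I}^d$. (ii) If $\gamma^{dis}$ has full support $[0,\infty)$, then $\mu_C^{dis}$ has full support $\mathbb{I}^d$. (iii) If $\gamma^{sing}$ has full support $[0,\infty)$, then $\mu_C^{sing}$ has full support $\mathbb{I}^d$.
   Context: Notation: $\mathbb{I}=[0,1]$; conventions $\inf\emptyset=\infty$, $1/\infty=0$, $1/0=\infty$. The support of a finite Borel measure is the complement of the union of all open sets of measure $0$. Archimedean copulas and Williamson measures. A generator is a continuous non-increasing $\psi:[0,\infty)\to\mathbb{I}$ with $\psi(0)=1$, $\psi(\infty):=\lim_{z\to\infty}\psi(z)=0$, strictly decreasing on $[0,\inf\{x:\psi(x)=0\})$; its pseudo-inverse is $\varphi(y)=\inf\{z\in[0,\infty]:\psi(z)=y\}$, $y\in\mathbb{I}$. All generators are normalized by $\psi(1)=\frac12$. A $d$-dimensional Archimedean copula is a copula of the form $C(\mathbf{x})=\psi(\sum_{i=1}^d\varphi(x_i))$; this function is a copula iff $\psi$ is $d$-monotone, i.e. (with $\psi$ continuous on $[0,\infty)$) on $(0,\infty)$ $\psi$ is differentiable up to order $d-2$, $(-1)^k\psi^{(k)}\ge0$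 for $k\le d-2$, and $(-1)^{d-2}\psi^{(d-2)}$ is non-increasing and convex. $\mathcal{C}_{ar}^d$ is the set of all $d$-dimensional Archimedean copulas. $\mathcal{P}_{\mathcal{W}_d}$ is the set of Borel probability measures $\gamma$ on $[0,\infty)$ with $\gamma(\{0\})=0$ and $\int_{[0,1]}(1-t)^{d-1}d\gamma(t)=\frac12$. The map $\gamma\mapsto\psi$, $\psi(z)=\int_{[0,\infty)}(1-tz)_+^{d-1}d\gamma(t)$, is a bijection from $\mathcal{P}_{\mathcal{W}_d}$ onto the normalized $d$-monotone generators, and $\psi\mapsto C$ is a bijection onto $\mathcal{C}_{ar}^d$; the $\gamma$ associated in this way with $C$ is its Williamson measure. Decompositions. A finite measure is called discrete if it is concentrated on a countable set, and singular if it has no point masses and is concentrated on a Lebesgue null set. $\gamma^{abs},\gamma^{dis},\gamma^{sing}$ are the absolutely continuous (w.r.t. Lebesgue measure), discrete and singular parts of $\gamma$. $\mu_C$ is the probability measure on $\mathbb{I}^d$ with distribution function $C$; $C^{1:d-1}$ is the marginal copula of the first $d-1$ coordinates, with measure $\mu_{C^{1:d-1}}$ (always absolutely continuous for $C\in\mathcal{C}_{ar}^d$). Let $K_C:\mathbb{I}^{d-1}\times\mathcal{B}(\mathbb{I})\to\mathbb{I}$ be (a version of) the regular conditional distribution of the last coordinate given the first $d-1$ under $\mu_C$, and for each $\mathbf{x}$ let $K_C(\mathbf{x},\cdot)=K_C^{abs}(\mathbf{x},\cdot)+K_C^{dis}(\mathbf{x},\cdot)+K_C^{sing}(\mathbf{x},\cdot)$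 be its decomposition into absolutely continuous, discrete and singular (i.e. having no point masses and concentrated on a Lebesgue null set) parts; these are sub-Markov kernels. For $\ast\in\{abs,dis,sing\}$ the measure $\mu_C^{\ast}$ on $\mathbb{I}^d$ is defined by $\mu_C^{\ast}(E\times F)=\int_E K_C^{\ast}(\mathbf{x},F)\,d\mu_{C^{1:d-1}}(\mathbf{x})$ for Borel $E\subseteq\mathbb{I}^{d-1}$, $F\subseteq\mathbb{I}$. *)

theory Defs
  imports "HOL-Probability.Probability"
begin

text \<open>
  A point of $\mathbb{R}^d$, $d \ge 2$, is a pair \<open>(x, y) :: (real^'n) \<times> real\<close> with
  \<open>CARD('n) = d - 1\<close>: \<open>x\<close> holds the first $d-1$ coordinates and \<open>y\<close> is the last one.
  Measures on $[0,1]^d$, $[0,1]$ and $[0,\infty)$ are Borel measures on the surrounding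
  Euclidean space that do not charge the complement. Copulas are real functions on the whole
  space of which only the values on the unit cube matter.
\<close>

section \<open>Supports and the Lebesgue decomposition\<close>

definition measure_support :: "'a::topological_space measure \<Rightarrow> 'a set" where
  "measure_support M = - \<Union>{U. open U \<and> emeasure M U = 0}"

definition discrete_measure :: "real measure \<Rightarrow> bool" where
  "discrete_measure M \<longleftrightarrow> (\<exists>S. countable S \<and> emeasure M (- S) = 0)"

definition singular_measure :: "real measure \<Rightarrow> bool" where
  "singular_measure M \<longleftrightarrow>
     (\<forall>x. emeasure M {x} = 0) \<and> (\<exists>N \<in> null_sets lborel. emeasure M (- N) = 0)"

definition lebesgue_decomposition ::
    "real measure \<Rightarrow> real measure \<Rightarrow> real measure \<Rightarrow> real measure \<Rightarrow> bool" where
  "lebesgue_decomposition M Mabs Mdis Msing \<longleftrightarrow>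
     (\<forall>N \<in> {Mabs, Mdis, Msing}. finite_measure N \<and> sets N = sets borel) \<and>
     absolutely_continuous lborel Mabs \<and> discrete_measure Mdis \<and> singular_measure Msing \<and>
     (\<forall>A \<in> sets borel. emeasure M A = emeasure Mabs A + emeasure Mdis A + emeasure Msing A)"

section \<open>Archimedean copulas\<close>

definition normalized_generator :: "(real \<Rightarrow> real) \<Rightarrow> bool" where
  "normalized_generator \<psi> \<longleftrightarrow>
     continuous_on {0..} \<psi> \<and> \<psi> ` {0..} \<subseteq> {0..1} \<and> antimono_on {0..} \<psi> \<and>
     \<psi> 0 = 1 \<and> (\<psi> \<longlongrightarrow> 0) at_top \<and>
     strict_antimono_on
       {z. 0 \<le> z \<and> ennreal z < Inf (ennreal ` {x. 0 \<le> x \<and> \<psi> x = 0})} \<psi> \<and>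
     \<psi> 1 = 1 / 2"

definition extend_generator :: "(real \<Rightarrow> real) \<Rightarrow> ennreal \<Rightarrow> real" where
  "extend_generator \<psi> z = (if z = \<infinity> then Lim at_top \<psi> else \<psi> (enn2real z))"

definition pseudo_inverse :: "(real \<Rightarrow> real) \<Rightarrow> real \<Rightarrow> ennreal" where
  "pseudo_inverse \<psi> y = Inf {z. extend_generator \<psi> z = y}"

definition archimedean_function :: "(real \<Rightarrow> real) \<Rightarrow> (real^'n) \<times> real \<Rightarrow> real" where
  "archimedean_function \<psi> =
     (\<lambda>(x, y). extend_generator \<psi> ((\<Sum>i\<in>UNIV. pseudo_inverse \<psi> (x $ i)) + pseudo_inverse \<psi> y))"

definition unit_cube :: "((real^'n) \<times> real) set" where
  "unit_cube = {0..1} \<times> {0..1}"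

definition has_distribution_function ::
    "((real^'n) \<times> real) measure \<Rightarrow> ((real^'n) \<times> real \<Rightarrow> real) \<Rightarrow> bool" where
  "has_distribution_function \<mu> C \<longleftrightarrow>
     prob_space \<mu> \<and> sets \<mu> = sets borel \<and> emeasure \<mu> (- unit_cube) = 0 \<and>
     (\<forall>x y. (x, y) \<in> unit_cube \<longrightarrow> measure \<mu> ({..x} \<times> {..y}) = C (x, y))"

definition copula :: "((real^'n) \<times> real \<Rightarrow> real) \<Rightarrow> bool" where
  "copula C \<longleftrightarrow>
     (\<exists>\<mu>. has_distribution_function \<mu> C \<and>
        (\<forall>i. distr \<mu> borel (\<lambda>(x, y). x $ i) = uniform_measure lborel {0..1}) \<and>
        distr \<mu> borel snd = uniform_measure lborel {0..1})"

definition generates :: "(real \<Rightarrow> real) \<Rightarrow> ((real^'n) \<times> real \<Rightarrow> real) \<Rightarrow> bool" where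
  "generates \<psi> C \<longleftrightarrow>
     normalized_generator \<psi> \<and> (\<forall>p \<in> unit_cube. C p = archimedean_function \<psi> p)"

definition archimedean_copulas :: "((real^'n) \<times> real \<Rightarrow> real) set" where
  "archimedean_copulas = {C. copula C \<and> (\<exists>\<psi>. generates \<psi> C)}"

section \<open>Williamson measures\<close>

definition williamson_measures :: "nat \<Rightarrow> real measure set" where
  "williamson_measures d =
     {\<gamma>. prob_space \<gamma> \<and> sets \<gamma> = sets borel \<and> emeasure \<gamma> {..<0} = 0 \<and> emeasure \<gamma> {0} = 0 \<and>
         (LINT t:{0..1}|\<gamma>. (1 - t) ^ (d - 1)) = 1 / 2}"

definition williamson_transform :: "nat \<Rightarrow> real measure \<Rightarrow> real \<Rightarrow> real" where
  "williamson_transform d \<gamma> z = (LINT t:{0..}|\<gamma>. (max 0 (1 - t * z)) ^ (d - 1))"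

definition is_williamson_measure_of ::
    "nat \<Rightarrow> real measure \<Rightarrow> ((real^'n) \<times> real \<Rightarrow> real) \<Rightarrow> bool" where
  "is_williamson_measure_of d \<gamma> C \<longleftrightarrow>
     \<gamma> \<in> williamson_measures d \<and>
     (\<exists>\<psi>. generates \<psi> C \<and> (\<forall>z\<ge>0. \<psi> z = williamson_transform d \<gamma> z))"

section \<open>Kernels\<close>

definition marginal :: "((real^'n) \<times> real) measure \<Rightarrow> (real^'n) measure" where
  "marginal \<mu> = distr \<mu> borel fst"

text \<open>
  \<open>kernel_composition \<nu> K M\<close>: \<open>M\<close> is the measure on the unit cube with
  $M(E \times F) = \int_E K(x, F) \, d\nu(x)$. Finiteness of \<open>\<nu>\<close> and of the kernel makes \<open>M\<close>
  unique, since the rectangles generate the Borel sets.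
\<close>
definition kernel_composition ::
    "(real^'n) measure \<Rightarrow> (real^'n \<Rightarrow> real measure) \<Rightarrow> ((real^'n) \<times> real) measure \<Rightarrow> bool" where
  "kernel_composition \<nu> K M \<longleftrightarrow>
     sets M = sets borel \<and> emeasure M (- unit_cube) = 0 \<and>
     (\<forall>E \<in> sets borel. \<forall>F \<in> sets borel. E \<subseteq> {0..1} \<longrightarrow> F \<subseteq> {0..1} \<longrightarrow>
        emeasure M (E \<times> F) = (\<integral>\<^sup>+x\<in>E. emeasure (K x) F \<partial>\<nu>))"

definition regular_conditional_distribution ::
    "((real^'n) \<times> real) measure \<Rightarrow> (real^'n \<Rightarrow> real measure) \<Rightarrow> bool" where
  "regular_conditional_distribution \<mu> K \<longleftrightarrow>
     K \<in> restrict_space borel {0..1} \<rightarrow>\<^sub>M prob_algebra borel \<and>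
     (\<forall>x \<in> {0..1}. emeasure (K x) (- {0..1}) = 0) \<and>
     kernel_composition (marginal \<mu>) K \<mu>"

end

theory Submission
  imports Defs
begin

text \<open>
  Let $X = R S$ with $1/R$ distributed as \<open>\<gamma>\<close> and $S$ uniform on the unit simplex; then
  $(\psi(X_1), \dots, \psi(X_d))$ has law $\mu_C$. By Fubini, given that the first $d-1$
  coordinates are $x$, and with $s = \sum_i \varphi(x_i)$, the last coordinate is distributed,
  up to normalization, as the image of $t^{d-1}\,d\gamma(t)$ on $(0, 1/s]$ under
  $T_s(t) = \psi(1/t - s)$. A generator whose Williamson measure charges every neighbourhood
  of $0$ is locally bi-Lipschitz on $(0, \infty)$, so $T_s$ is injective and preserves null sets
  in both directions. Hence it carries the three parts of \<open>\<gamma>\<close> to the three parts of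
  $K_C(x, \cdot)$, and a part of \<open>\<gamma>\<close> with full support charges every open subinterval of
  $(0, 1)$ for almost every $x$.
\<close>

subsection \<open>Lebesgue decompositions\<close>

text \<open>Each part is dominated by \<open>\<gamma>\<close>, so full support of a single part
  already makes \<open>\<gamma>\<close> charge every interval (0, e). This excludes zeros of the
  generator and gives it a real-valued inverse on (0, 1]. Slopes are estimated directly under the
  Williamson integral, since for d = 2 the generator need not be differentiable. The main obstacle
  is that the kernels are not explicit: \<open>K\<close> is an arbitrary version of the conditional
  distribution, and its three parts are only characterised by their properties. Therefore the law of
  the transformed simplex vector is built by hand and identified with \<open>\<mu>\<close> through
  its distribution function. \<open>K\<close> agrees with the explicit kernel outside one null set,
  and there uniqueness of the Lebesgue decomposition forces the parts to agree as well. The value s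
  = 0 must be avoided, because the unnormalised kernel may then have infinite mass; it corresponds
  only to the origin, a Lebesgue null set.\<close>

lemma lebesgue_decomposition_emeasure:
  assumes dec: "lebesgue_decomposition M A D S"
    and P: "countable P" "emeasure D (- P) = 0"
    and N: "N \<in> null_sets lborel" "emeasure S (- N) = 0" "P \<subseteq> N"
    and B: "B \<in> sets borel"
  shows "emeasure A B = emeasure M (B - N)"
    and "emeasure D B = emeasure M (B \<inter> P)"
    and "emeasure S B = emeasure M (B \<inter> (N - P))"
proof -
  have sets [simp]: "sets A = sets borel" "sets D = sets borel" "sets S = sets borel"
    and abs: "absolutely_continuous lborel A" and sing: "\<And>x. emeasure S {x} = 0"
    and sum: "\<And>X. X \<in> sets borel \<Longrightarrow> emeasure M X = emeasure A X + emeasure D X + emeasure S X"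
    using dec by (auto simp: lebesgue_decomposition_def singular_measure_def)
  have sets_PN [simp]: "P \<in> sets borel" "N \<in> sets borel"
    using P(1) N(1) by (auto intro: sets.countable)
  have null_A: "emeasure A X = 0" if "X \<subseteq> N" "X \<in> sets borel" for X
  proof -
    have "N \<in> null_sets A"
      using abs N(1) by (auto simp: absolutely_continuous_def)
    then show ?thesis
      using that emeasure_eq_0[of N A X] by auto
  qed
  have null_D: "emeasure D X = 0" if "X \<subseteq> - P" "X \<in> sets borel" for X
    by (rule emeasure_eq_0[of "- P" D X]) (use that P(2) in \<open>simp_all add: borel_comp\<close>)
  \<comment> \<open>A measure without atoms ignores countable sets; this separates the singular part
    from the discrete one.\<close>
  have null_P: "P \<in> null_sets S"
  proof -
    have "(\<Union>x\<in>P. {x}) \<in> null_sets S"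
      using P(1) sing by (intro null_sets_UN') (auto simp: null_sets_def)
    then show ?thesis by simp
  qed
  have null_S: "emeasure S X = 0" if "X \<subseteq> - N \<union> P" "X \<in> sets borel" for X
    by (rule emeasure_eq_0[of "- N \<union> P" S X]) (use that N(2) null_P in \<open>simp_all add: emeasure_Un_null_set borel_comp sets.Un\<close>)
  have split: "emeasure L B = emeasure L (B \<inter> Q)"
    if "sets L = sets borel" "Q \<in> sets borel" "emeasure L (B - Q) = 0" for L :: "real measure" and Q
  proof -
    have "emeasure L B = emeasure L (B \<inter> Q \<union> (B - Q))"
      by (rule arg_cong[where f = "emeasure L"]) auto
    also have "\<dots> = emeasure L (B \<inter> Q)"
      using that B by (intro emeasure_Un_null_set) (auto simp: null_sets_def)
    finally show ?thesis .
  qed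
  have in_borel: "B \<inter> - N \<in> sets borel" "B \<inter> P \<in> sets borel" "B \<inter> (N - P) \<in> sets borel"
    using B by (auto intro!: sets.Int sets.Diff borel_comp)
  have "emeasure A B = emeasure A (B \<inter> - N)"
    using B by (intro split null_A) (auto intro: borel_comp)
  moreover have "emeasure D (B \<inter> - N) = 0" "emeasure S (B \<inter> - N) = 0"
    using in_borel N(3) by (auto intro!: null_D null_S)
  ultimately show "emeasure A B = emeasure M (B - N)"
    using sum[OF in_borel(1)] by (simp add: Diff_eq)
  have "emeasure D B = emeasure D (B \<inter> P)"
    using B by (intro split null_D) auto
  moreover have "emeasure A (B \<inter> P) = 0" "emeasure S (B \<inter> P) = 0"
    using in_borel N(3) by (auto intro!: null_A null_S)
  ultimately show "emeasure D B = emeasure M (B \<inter> P)"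
    using sum[OF in_borel(2)] by simp
  have "emeasure S B = emeasure S (B \<inter> (N - P))"
    using B by (intro split null_S) (auto intro!: sets.Diff)
  moreover have "emeasure A (B \<inter> (N - P)) = 0" "emeasure D (B \<inter> (N - P)) = 0"
    using in_borel by (auto intro!: null_A null_D)
  ultimately show "emeasure S B = emeasure M (B \<inter> (N - P))"
    using sum[OF in_borel(3)] by simp
qed

text \<open>The carriers of both decompositions are merged into one countable P inside one Lebesgue
  null set N. Off N only the absolutely continuous part survives, on P only the discrete one, on N -
  P only the singular one, so M determines all three.\<close>

lemma lebesgue_decomposition_unique:
  assumes dec1: "lebesgue_decomposition M A1 D1 S1" and dec2: "lebesgue_decomposition M A2 D2 S2"
    and B: "B \<in> sets borel"
  shows "emeasure A1 B = emeasure A2 B \<and> emeasure D1 B = emeasure D2 B \<and> emeasure S1 B = emeasure S2 B"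
proof -
  obtain P1 P2 where P: "countable P1" "emeasure D1 (- P1) = 0" "countable P2" "emeasure D2 (- P2) = 0"
    using dec1 dec2 by (auto simp: lebesgue_decomposition_def discrete_measure_def)
  obtain N1 N2 where N: "N1 \<in> null_sets lborel" "emeasure S1 (- N1) = 0"
      "N2 \<in> null_sets lborel" "emeasure S2 (- N2) = 0"
    using dec1 dec2 by (auto simp: lebesgue_decomposition_def singular_measure_def)
  define P where "P = P1 \<union> P2"
  define N where "N = N1 \<union> N2 \<union> P"
  have cP: "countable P" using P by (auto simp: P_def)
  then have "P \<in> null_sets lborel"
    by (simp add: countable_imp_null_set_lborel)
  then have nN: "N \<in> null_sets lborel"
    using N by (auto simp: N_def)
  have [simp]: "sets D1 = sets borel" "sets D2 = sets borel" "sets S1 = sets borel" "sets S2 = sets borel"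
    using dec1 dec2 by (auto simp: lebesgue_decomposition_def)
  have [simp]: "P \<in> sets borel" "P1 \<in> sets borel" "P2 \<in> sets borel"
    using cP P by (auto intro: sets.countable)
  have zero: "emeasure L (- X) = 0"
    if "sets L = sets borel" "Y \<in> sets borel" "emeasure L (- Y) = 0" "Y \<subseteq> X" for L :: "real measure" and X Y
    by (rule emeasure_eq_0[of "- Y" L]) (use that in \<open>simp_all add: borel_comp\<close>)
  have D: "emeasure D1 (- P) = 0" "emeasure D2 (- P) = 0"
    by (rule zero[of D1 P1 P] zero[of D2 P2 P]; use P in \<open>simp add: P_def\<close>)+
  have S: "emeasure S1 (- N) = 0" "emeasure S2 (- N) = 0"
    using N zero[of S1 N1 N] zero[of S2 N2 N] by (simp_all add: N_def null_sets_def subset_eq)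
  have PN: "P \<subseteq> N" by (auto simp: N_def)
  show ?thesis
    using lebesgue_decomposition_emeasure[OF dec1 cP D(1) nN S(1) PN B]
      lebesgue_decomposition_emeasure[OF dec2 cP D(2) nN S(2) PN B] by simp
qed

lemma lebesgue_decomposition_scale_measure:
  assumes dec: "lebesgue_decomposition M A D S" and r: "r < \<infinity>" and M: "sets M = sets borel"
  shows "lebesgue_decomposition (scale_measure r M) (scale_measure r A) (scale_measure r D) (scale_measure r S)"
proof -
  have "finite_measure (scale_measure r L)" if "finite_measure L" for L :: "real measure"
    using that r by (intro finite_measureI)
      (auto simp: space_scale_measure finite_measure.emeasure_finite ennreal_mult_eq_top_iff less_top
        ennreal_mult_less_top)
  then show ?thesis
    using dec M unfolding lebesgue_decomposition_def discrete_measure_def singular_measure_def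
      absolutely_continuous_def
    by (auto simp: null_sets_def distrib_left)
qed

subsection \<open>Supports, volumes and distribution functions\<close>

text \<open>Images of null sets are known only to be Lebesgue null and may fail to be Borel, while
  all measures here live on the Borel sets. A Borel null superset bridges the gap.\<close>

lemma null_sets_lborel_superset:
  assumes "negligible X"
  obtains N where "N \<in> null_sets lborel" "X \<subseteq> N"
  using assms by (auto simp: negligible_iff_null_sets null_sets_completion_iff2)

lemma measure_support_emeasure_pos:
  assumes "measure_support M = T" "open U" "U \<inter> T \<noteq> {}"
  shows "0 < emeasure M U"
proof (rule ccontr)
  assume "\<not> 0 < emeasure M U"
  then have "U \<subseteq> - measure_support M"
    using assms(2) unfolding measure_support_def by auto
  then show False using assms(1,3) by auto
qed

text \<open>An affine image of the standard simplex, scaled by c minus the coordinate sum of a. This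
  volume is what turns into the integrand of the Williamson transform.\<close>

lemma emeasure_lborel_corner_simplex:
  fixes a :: "real^'n"
  shows "emeasure lborel {z. (\<forall>i. a $ i \<le> z $ i) \<and> (\<Sum>i\<in>UNIV. z $ i) \<le> c} =
    ennreal (max 0 (c - (\<Sum>i\<in>UNIV. a $ i)) ^ CARD('n) / fact CARD('n))"
proof -
  define r where "r = c - (\<Sum>i\<in>UNIV. a $ i)"
  define X where "X = {z. (\<forall>i. a $ i \<le> z $ i) \<and> (\<Sum>i\<in>UNIV. z $ i) \<le> c}"
  have X_borel [measurable]: "X \<in> sets borel" unfolding X_def by measurable
  consider "r > 0" | "r \<le> 0" by linarith
  then have "emeasure lborel X = ennreal (max 0 r ^ CARD('n) / fact CARD('n))"
  proof cases
    case 1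
    have Basis_range: "Basis = range (\<lambda>i::'n. axis i (1::real))"
      by (auto simp: Basis_vec_def)
    have "inj (\<lambda>i::'n. axis i (1::real))"
      by (simp add: inj_on_def axis_eq_axis)
    then have Basis_sum: "(\<Sum>b\<in>(Basis :: (real^'n) set). f b) = (\<Sum>i\<in>UNIV. f (axis i 1))"
      for f :: "_ \<Rightarrow> real"
      unfolding Basis_range by (subst sum.reindex) simp_all
    have pre: "a + r *\<^sub>R x \<in> X \<longleftrightarrow> x \<in> convex hull (insert 0 Basis)" for x :: "real^'n"
    proof -
      have "(\<Sum>i\<in>UNIV. (a + r *\<^sub>R x) $ i) \<le> c \<longleftrightarrow> r * (\<Sum>i\<in>UNIV. x $ i) \<le> r * 1"
        unfolding r_def by (simp add: sum.distrib sum_distrib_left) linarith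
      then have sum: "(\<Sum>i\<in>UNIV. (a + r *\<^sub>R x) $ i) \<le> c \<longleftrightarrow> (\<Sum>i\<in>UNIV. x $ i) \<le> 1"
        using 1 by (metis mult_le_cancel_left_pos)
      have coord: "(\<forall>i. a $ i \<le> (a + r *\<^sub>R x) $ i) \<longleftrightarrow> (\<forall>i. 0 \<le> x $ i)"
        using 1 by (simp add: zero_le_mult_iff)
      have basis: "(\<forall>i. 0 \<le> x $ i) \<longleftrightarrow> (\<forall>b\<in>Basis. 0 \<le> x \<bullet> b)"
        unfolding Basis_range by (simp add: inner_axis)
      show ?thesis
        unfolding X_def std_simplex mem_Collect_eq sum coord basis
        by (simp add: Basis_sum inner_axis)
    qed
    have "emeasure lborel X =
        emeasure (density (distr lborel borel (\<lambda>x. a + r *\<^sub>R x)) (\<lambda>_. \<bar>r\<bar> ^ DIM(real^'n))) X"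
      using 1 by (subst lborel_affine[of r a]) auto
    also have "\<dots> = ennreal (r ^ CARD('n)) * emeasure lborel ((\<lambda>x. a + r *\<^sub>R x) -` X)"
      using 1 by (subst emeasure_density_const) (auto simp: emeasure_distr)
    also have "(\<lambda>x. a + r *\<^sub>R x) -` X = convex hull (insert 0 Basis)"
      using pre by auto
    also have "emeasure lborel \<dots> = ennreal (1 / fact CARD('n))"
      by (subst emeasure_std_simplex) simp
    finally show ?thesis
      using 1 by (simp add: ennreal_mult[symmetric])
  next
    case 2
    \<comment> \<open>In the degenerate case at most the corner remains. It is null because the
      dimension is positive, which is also why the power of 0 on the right vanishes.\<close>
    have "X \<subseteq> {a}"
    proof
      fix z assume z: "z \<in> X"
      have "(\<Sum>i\<in>UNIV. z $ i - a $ i) = 0"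
        using z 2 sum_nonneg[of UNIV "\<lambda>i. z $ i - a $ i"]
        by (auto simp: X_def r_def sum_subtractf)
      then have "z $ i - a $ i = 0" for i
        using z by (subst (asm) sum_nonneg_eq_0_iff) (auto simp: X_def)
      then show "z \<in> {a}" by (simp add: vec_eq_iff)
    qed
    then have "emeasure lborel X = 0"
      using emeasure_eq_0[of "{a}" lborel X] by simp
    then show ?thesis using 2 by simp
  qed
  then show ?thesis by (simp add: X_def r_def)
qed

section \<open>Increments of powers\<close>

lemma power_diff_lower:
  fixes x y :: real
  assumes "0 \<le> y" "y \<le> x" "0 < n"
  shows "(x - y) * x ^ (n - 1) \<le> x ^ n - y ^ n"
proof -
  have "y * y ^ (n - 1) \<le> y * x ^ (n - 1)"
    using assms by (intro mult_left_mono power_mono) auto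
  then show ?thesis
    using assms(3) by (simp add: power_eq_if left_diff_distrib)
qed

lemma power_diff_upper:
  fixes x y :: real
  assumes "0 \<le> y" "y \<le> x" "x \<le> 1"
  shows "x ^ n - y ^ n \<le> n * (x - y)"
proof (induction n)
  case (Suc n)
  have "x ^ Suc n - y ^ Suc n = x * (x ^ n - y ^ n) + (x - y) * y ^ n"
    by (simp add: algebra_simps)
  also have "\<dots> \<le> 1 * (x ^ n - y ^ n) + (x - y) * 1"
    using assms by (intro add_mono mult_right_mono mult_left_mono power_le_one)
      (auto intro: power_mono)
  finally show ?case using Suc by (simp add: algebra_simps)
qed simp

lemma sum_vec_pos:
  fixes z :: "real^'n"
  assumes "0 \<le> z" "z \<noteq> 0" shows "0 < (\<Sum>i\<in>UNIV. z $ i)"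
proof -
  obtain i where "z $ i \<noteq> 0" using assms(2) by (auto simp: vec_eq_iff)
  then show ?thesis
    using assms(1) by (intro sum_pos2[of _ i]) (auto simp: less_eq_vec_def order_less_le)
qed

lemma vec_nth_measurable [measurable (raw)]:
  assumes "f \<in> borel_measurable M"
  shows "(\<lambda>x. f x $ i :: real) \<in> borel_measurable M"
  by (rule measurable_compose[OF assms]) simp

text \<open>Countably many half-lines suffice, so equalities that hold almost everywhere for each
  half-line combine into an almost everywhere equality of measures.\<close>

lemma measure_eqI_rat_atMost:
  fixes M N :: "real measure"
  assumes sets: "sets M = sets borel" "sets N = sets borel" and "finite_measure M"
    and eq: "\<And>q. q \<in> \<rat> \<Longrightarrow> emeasure M {..q} = emeasure N {..q}"
  shows "M = N"
proof -
  have borel: "borel = sigma UNIV (atMost ` (\<rat> :: real set))"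
  proof (rule borel_eq_sigmaI1[OF borel_eq_atMost])
    fix X :: "real set" assume "X \<in> range atMost"
    then obtain a where X: "X = {..a}" by auto
    have "{..a} = (\<Inter>q\<in>{q \<in> \<rat>. a < q}. {..q})"
    proof (intro equalityI subsetI)
      fix x assume x: "x \<in> (\<Inter>q\<in>{q \<in> \<rat>. a < q}. {..q})"
      have "\<not> a < x"
      proof
        assume "a < x"
        then obtain q where "q \<in> \<rat>" "a < q" "q < x" using Rats_dense_in_real by blast
        then show False using x by auto
      qed
      then show "x \<in> {..a}" by simp
    qed auto
    also have "\<dots> \<in> sets (sigma UNIV (atMost ` \<rat>))"
    proof (rule sets.countable_INT'')
      show "UNIV \<in> sets (sigma UNIV (atMost ` (\<rat> :: real set)))"
        using sets.top[of "sigma UNIV (atMost ` (\<rat> :: real set))"] by (simp add: space_measure_of_conv)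
      show "countable {q \<in> \<rat>. a < q}" by (rule countable_subset[OF _ countable_rat]) auto
    qed auto
    finally show "X \<in> sets (sigma UNIV (atMost ` \<rat>))" using X by simp
  qed auto
  interpret finite_measure M by fact
  have gen: "sets borel = sigma_sets UNIV (atMost ` (\<rat> :: real set))"
    by (subst borel) (rule sets_measure_of, simp)
  show ?thesis
  proof (rule measure_eqI_generator_eq[where \<Omega> = UNIV and E = "atMost ` \<rat>" and A = "\<lambda>k. {..real k}"])
    show "Int_stable (atMost ` (\<rat> :: real set))"
    proof (rule Int_stableI)
      fix X Y :: "real set" assume "X \<in> atMost ` \<rat>" "Y \<in> atMost ` \<rat>"
      then obtain x y where "X = {..x}" "Y = {..y}" "x \<in> \<rat>" "y \<in> \<rat>" by auto
      moreover have "{..x} \<inter> {..y} = {..min x y}" by auto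
      moreover have "min x y \<in> \<rat>" using calculation by (simp add: min_def)
      ultimately show "X \<inter> Y \<in> atMost ` \<rat>" by simp
    qed
    show "(\<Union>k. {..real k}) = UNIV" using real_arch_simple by auto
    show "emeasure M {..real k} \<noteq> \<infinity>" for k by simp
  qed (use eq sets gen in auto)
qed

lemma closed_unit_cube: "closed (unit_cube :: ((real^'n) \<times> real) set)"
  unfolding unit_cube_def by (intro closed_Times closed_atLeastAtMost) auto

text \<open>C prescribes values only at points of the cube. Since no mass lies outside, a lower
  corner at an arbitrary point can be cut back to the cube, or is null when some coordinate is
  negative; corners form an intersection-stable generator.\<close>

lemma has_distribution_function_unique:
  fixes \<mu> \<mu>' :: "((real^'n) \<times> real) measure"
  assumes \<mu>: "has_distribution_function \<mu> C" and \<mu>': "has_distribution_function \<mu>' C"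
  shows "\<mu> = \<mu>'"
proof -
  have truncate: "emeasure L {..(a, b)} =
      (if 0 \<le> a \<and> 0 \<le> b then ennreal (C (\<chi> i. min 1 (a $ i), min 1 b)) else 0)"
    if L: "has_distribution_function L C" for L and a :: "real^'n" and b :: real
  proof -
    interpret prob_space L using L by (simp add: has_distribution_function_def)
    have sets [simp, measurable_cong]: "sets L = sets borel" and cube: "emeasure L (- unit_cube) = 0"
      and cdf: "\<And>x y. (x, y) \<in> unit_cube \<Longrightarrow> measure L ({..x} \<times> {..y}) = C (x, y)"
      using L by (auto simp: has_distribution_function_def)
    have "- unit_cube \<in> null_sets L"
      using cube by (simp add: null_sets_def borel_comp borel_closed closed_unit_cube)
    from AE_not_in[OF this] have AE: "AE p in L. p \<in> unit_cube" by simp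
    show ?thesis
    proof (cases "0 \<le> a \<and> 0 \<le> b")
      case True
      define a' :: "real^'n" where "a' = (\<chi> i. min 1 (a $ i))"
      have "emeasure L {..(a, b)} = emeasure L ({..a'} \<times> {..min 1 b})"
        using AE by (intro emeasure_eq_AE)
          (auto elim!: eventually_mono simp: unit_cube_def a'_def less_eq_vec_def intro!: borel_Times)
      also have "\<dots> = ennreal (C (a', min 1 b))"
        using True cdf[of a' "min 1 b"]
        by (simp add: emeasure_eq_measure unit_cube_def a'_def less_eq_vec_def)
      finally show ?thesis using True by (simp add: a'_def)
    next
      case False
      have "emeasure L {..(a, b)} = emeasure L {}"
        using AE False by (intro emeasure_eq_AE)
          (auto elim!: eventually_mono simp: unit_cube_def intro: order_trans)
      then show ?thesis using False by (simp only: if_False emeasure_empty)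
    qed
  qed
  show ?thesis
  proof (rule measure_eqI_generator_eq[where \<Omega> = UNIV and E = "range atMost"
        and A = "\<lambda>k. {..((\<chi> i. real k), real k)}"])
    show "Int_stable (range (atMost :: (real^'n) \<times> real \<Rightarrow> _))"
    proof (rule Int_stableI)
      fix X Y :: "((real^'n) \<times> real) set" assume "X \<in> range atMost" "Y \<in> range atMost"
      then obtain x y where "X = {..x}" "Y = {..y}" by auto
      then have "X \<inter> Y = {..inf x y}" by auto
      then show "X \<inter> Y \<in> range atMost" by blast
    qed
    show "emeasure \<mu> X = emeasure \<mu>' X" if "X \<in> range atMost" for X
      using that truncate[OF \<mu>] truncate[OF \<mu>'] by auto
    have borel: "sets borel = sigma_sets UNIV (range (atMost :: (real^'n) \<times> real \<Rightarrow> _))"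
      by (subst borel_eq_atMost) (rule sets_measure_of, simp)
    show "sets \<mu> = sigma_sets UNIV (range atMost)" "sets \<mu>' = sigma_sets UNIV (range atMost)"
      using \<mu> \<mu>' borel by (auto simp: has_distribution_function_def)
    show "(\<Union>k. {..((\<chi> i. real k) :: real^'n, real k)}) = UNIV"
    proof (intro equalityI subsetI UNIV_I)
      fix p :: "(real^'n) \<times> real"
      obtain k :: nat where k: "norm p \<le> k" using real_arch_simple by blast
      have "fst p $ i \<le> k" for i
        using component_le_norm_cart[of "fst p" i] norm_fst_le[of "fst p" "snd p"] k by simp
      moreover have "snd p \<le> k" using norm_snd_le[of "snd p" "fst p"] k by simp
      ultimately show "p \<in> (\<Union>k. {..((\<chi> i. real k) :: real^'n, real k)})"
        by (auto simp: less_eq_prod_def less_eq_vec_def intro!: exI[of _ k])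
    qed
    show "emeasure \<mu> {..((\<chi> i. real k) :: real^'n, real k)} \<noteq> \<infinity>" for k
      unfolding truncate[OF \<mu>] by simp
  qed auto
qed

subsection \<open>Generators\<close>

text \<open>The one-dimensional setting, with n in the role of d - 1. The assumption
  \<open>\<gamma>_pos\<close> is the trace that full support of any one part leaves on
  \<open>\<gamma>\<close>.\<close>

locale positive_williamson_generator =
  fixes n :: nat and \<gamma> :: "real measure" and \<psi> :: "real \<Rightarrow> real"
  assumes n_pos: "0 < n"
    and prob_\<gamma>: "prob_space \<gamma>"
    and sets_\<gamma> [simp, measurable_cong]: "sets \<gamma> = sets borel"
    and \<gamma>_nonpos: "emeasure \<gamma> {..0} = 0"
    and \<gamma>_pos: "\<And>e. 0 < e \<Longrightarrow> 0 < emeasure \<gamma> {0<..<e}"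
    and \<psi>_eq: "\<And>z. 0 \<le> z \<Longrightarrow> \<psi> z = (LINT t:{0..}|\<gamma>. (max 0 (1 - t * z)) ^ n)"
    and cont: "continuous_on {0..} \<psi>"
    and \<psi>_0: "\<psi> 0 = 1"
    and \<psi>_lim: "(\<psi> \<longlongrightarrow> 0) at_top"
begin

sublocale \<gamma>: prob_space \<gamma> by (rule prob_\<gamma>)

lemma space_\<gamma> [simp]: "space \<gamma> = UNIV"
  using sets_eq_imp_space_eq[OF sets_\<gamma>] by simp

lemma AE_pos: "AE t in \<gamma>. 0 < t"
  using \<gamma>_nonpos by (intro AE_I[of _ _ "{..0}"]) auto

lemma integrable_transform:
  assumes "0 \<le> z"
  shows "integrable \<gamma> (\<lambda>t. indicator {0..} t * (max 0 (1 - t * z)) ^ n)"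
  using assms
  by (intro \<gamma>.integrable_const_bound[of _ 1] AE_I2) (auto simp: indicator_def power_le_one_iff)

lemma \<psi>_eq': "0 \<le> z \<Longrightarrow> \<psi> z = (LINT t|\<gamma>. indicator {0..} t * (max 0 (1 - t * z)) ^ n)"
  using \<psi>_eq[of z] by (simp add: set_lebesgue_integral_def)

lemma \<psi>_nonneg: "0 \<le> z \<Longrightarrow> 0 \<le> \<psi> z"
  unfolding \<psi>_eq' by (intro integral_nonneg_AE AE_I2) (auto simp: indicator_def)

lemma \<psi>_nn_integral:
  assumes "0 \<le> z"
  shows "ennreal (\<psi> z) = (\<integral>\<^sup>+t. indicator {0<..} t * ennreal ((max 0 (1 - t * z)) ^ n) \<partial>\<gamma>)"
proof -
  have "ennreal (\<psi> z) = (\<integral>\<^sup>+t. ennreal (indicator {0..} t * (max 0 (1 - t * z)) ^ n) \<partial>\<gamma>)"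
    unfolding \<psi>_eq'[OF assms]
    by (intro nn_integral_eq_integral[symmetric] integrable_transform assms AE_I2) (auto simp: indicator_def)
  also have "\<dots> = (\<integral>\<^sup>+t. indicator {0<..} t * ennreal ((max 0 (1 - t * z)) ^ n) \<partial>\<gamma>)"
    using AE_pos by (intro nn_integral_cong_AE) (auto elim!: eventually_mono simp: indicator_def)
  finally show ?thesis .
qed

text \<open>For t < 1 / (2 b) the base 1 - t z stays above 1/2 on all of [0, b], so the integrand
  falls at rate at least t (1/2)^(n-1) there. Integrating this rate over those t gives c, which is
  positive because \<open>\<gamma>\<close> charges them.\<close>

lemma \<psi>_decrease_lower:
  assumes b: "0 < b"
  obtains c where "0 < c" "\<And>z z'. 0 \<le> z \<Longrightarrow> z \<le> z' \<Longrightarrow> z' \<le> b \<Longrightarrow> c * (z' - z) \<le> \<psi> z - \<psi> z'"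
proof
  let ?J = "{0<..<1 / (2 * b)}"
  let ?f = "\<lambda>t. indicator ?J t * t * (1 / 2) ^ (n - 1) :: real"
  have f_nonneg: "0 \<le> ?f t" for t
    by (simp add: indicator_def)
  have f_bound: "?f t \<le> 1 / (2 * b)" for t
  proof (cases "t \<in> ?J")
    case True
    then have "t * (1 / 2) ^ (n - 1) \<le> 1 / (2 * b) * 1"
      using b by (intro mult_mono power_le_one) auto
    then show ?thesis using True by simp
  qed (use b in simp)
  have int: "integrable \<gamma> ?f"
  proof (rule \<gamma>.integrable_const_bound[of _ "1 / (2 * b)"])
    show "AE t in \<gamma>. norm (?f t) \<le> 1 / (2 * b)"
      using f_bound f_nonneg by (intro AE_I2) (simp only: real_norm_def abs_of_nonneg)
  qed measurable
  have "integral\<^sup>L \<gamma> ?f \<noteq> 0"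
  proof
    assume "integral\<^sup>L \<gamma> ?f = 0"
    then have "AE t in \<gamma>. ?f t = 0"
      using int f_nonneg by (subst (asm) integral_nonneg_eq_0_iff_AE) (simp_all only: AE_I2)
    then have "AE t in \<gamma>. t \<notin> ?J"
      by eventually_elim (auto simp: indicator_def split: if_splits)
    then have "emeasure \<gamma> ?J = 0"
      by (subst (asm) AE_iff_measurable[of ?J]) auto
    then show False using \<gamma>_pos[of "1 / (2 * b)"] b by simp
  qed
  moreover have "0 \<le> integral\<^sup>L \<gamma> ?f"
    by (intro integral_nonneg_AE AE_I2 f_nonneg)
  ultimately show "0 < integral\<^sup>L \<gamma> ?f" by linarith
  fix z z' :: real assume z: "0 \<le> z" "z \<le> z'" "z' \<le> b"
  have "integral\<^sup>L \<gamma> ?f * (z' - z) = (LINT t|\<gamma>. ?f t * (z' - z))"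
    by simp
  also have "\<dots> \<le> (LINT t|\<gamma>. indicator {0..} t * (max 0 (1 - t * z)) ^ n -
      indicator {0..} t * (max 0 (1 - t * z')) ^ n)"
  proof (intro integral_mono Bochner_Integration.integrable_diff integrable_transform)
    show "integrable \<gamma> (\<lambda>t. ?f t * (z' - z))"
      by (rule integrable_mult_left) (rule int)
    fix t :: real
    consider "t < 0" | "0 \<le> t" "t \<notin> ?J" | "t \<in> ?J" by linarith
    then show "?f t * (z' - z) \<le> indicator {0..} t * (max 0 (1 - t * z)) ^ n -
        indicator {0..} t * (max 0 (1 - t * z')) ^ n"
    proof cases
      case 2
      then have "max 0 (1 - t * z') ^ n \<le> max 0 (1 - t * z) ^ n"
        using z by (intro power_mono max.mono diff_left_mono mult_left_mono) auto
      then show ?thesis using 2(1) by (simp add: indicator_simps(2)[OF 2(2)])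
    next
      case 3
      have tz: "t * z \<le> t * z'" using 3 z by (intro mult_left_mono) auto
      have "t * z' \<le> 1 / (2 * b) * b" using 3 z b by (intro mult_mono) auto
      then have half: "t * z' \<le> 1 / 2" using b by simp
      then have half': "t * z \<le> 1 / 2" using tz by linarith
      have "t * (z' - z) * (1 / 2) ^ (n - 1) \<le> t * (z' - z) * (1 - t * z) ^ (n - 1)"
        using 3 z half' by (intro mult_left_mono power_mono) auto
      also have "\<dots> = ((1 - t * z) - (1 - t * z')) * (1 - t * z) ^ (n - 1)"
        by (simp add: algebra_simps)
      also have "\<dots> \<le> (1 - t * z) ^ n - (1 - t * z') ^ n"
        using n_pos tz half by (intro power_diff_lower) auto
      finally show ?thesis using 3 half half' by (simp add: mult_ac)
    qed (simp add: indicator_def)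
  qed (use z in auto)
  also have "\<dots> = \<psi> z - \<psi> z'"
    using z by (simp add: \<psi>_eq' Bochner_Integration.integral_diff integrable_transform)
  finally show "integral\<^sup>L \<gamma> ?f * (z' - z) \<le> \<psi> z - \<psi> z'" .
qed

text \<open>Only t < 1 / z \<le> 1 / a contribute: for larger t the integrand is already 0 at z.
  Staying away from 0 matters, because the slope at 0 is infinite when \<open>\<gamma>\<close> has
  infinite mean.\<close>

lemma \<psi>_decrease_upper:
  assumes a: "0 < a" "a \<le> z" "z \<le> z'"
  shows "\<psi> z - \<psi> z' \<le> n / a * (z' - z)"
proof -
  have "\<psi> z - \<psi> z' = (LINT t|\<gamma>. indicator {0..} t * (max 0 (1 - t * z)) ^ n -
      indicator {0..} t * (max 0 (1 - t * z')) ^ n)"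
    using a by (simp add: \<psi>_eq' Bochner_Integration.integral_diff integrable_transform)
  also have "\<dots> \<le> (LINT t|\<gamma>. n / a * (z' - z))"
  proof (intro integral_mono Bochner_Integration.integrable_diff integrable_transform)
    fix t :: real
    have nonneg: "0 \<le> n / a * (z' - z)" using a by simp
    consider "t < 0" | "0 \<le> t" "1 \<le> t * z" | "0 \<le> t" "t * z < 1" by linarith
    then show "indicator {0..} t * (max 0 (1 - t * z)) ^ n - indicator {0..} t * (max 0 (1 - t * z')) ^ n
        \<le> n / a * (z' - z)"
    proof cases
      case 2
      then have "indicator {0..} t * (max 0 (1 - t * z)) ^ n - indicator {0..} t * (max 0 (1 - t * z')) ^ n
          = - (max 0 (1 - t * z') ^ n)"
        using n_pos by (simp add: zero_power)
      also have "\<dots> \<le> 0" by simp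
      finally show ?thesis using nonneg by linarith
    next
      case 3
      have "t * a \<le> t * z" using 3 a by (intro mult_left_mono) auto
      then have ta: "t \<le> 1 / a" using 3 a by (simp add: field_simps)
      have tz: "t * z \<le> t * z'" using 3 a by (intro mult_left_mono) auto
      have "max 0 (1 - t * z) ^ n - max 0 (1 - t * z') ^ n \<le> n * (max 0 (1 - t * z) - max 0 (1 - t * z'))"
        using 3 tz a by (intro power_diff_upper) auto
      also have "\<dots> \<le> n * (t * (z' - z))"
        using 3 tz by (intro mult_left_mono) (auto simp: algebra_simps)
      also have "\<dots> \<le> n * (1 / a * (z' - z))"
        using ta a by (intro mult_left_mono mult_right_mono) auto
      finally show ?thesis using 3 by (simp add: indicator_def)
    qed (use nonneg in \<open>simp add: indicator_def\<close>)
  qed (use a in auto)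
  also have "\<dots> = n / a * (z' - z)" by (simp add: \<gamma>.prob_space[simplified])
  finally show ?thesis .
qed

section \<open>Strict monotonicity and the inverse of the generator\<close>

lemma \<psi>_strict:
  assumes "0 \<le> z" "z < z'" shows "\<psi> z' < \<psi> z"
proof -
  have "0 < z'" using assms by simp
  then obtain c where "0 < c" "c * (z' - z) \<le> \<psi> z - \<psi> z'"
    using \<psi>_decrease_lower[of z'] assms by (metis less_eq_real_def)
  then show ?thesis using assms by (smt (verit) mult_pos_pos)
qed

lemma \<psi>_less_iff: "0 \<le> z \<Longrightarrow> 0 \<le> z' \<Longrightarrow> \<psi> z' < \<psi> z \<longleftrightarrow> z < z'"
  using \<psi>_strict by (metis linorder_neqE_linordered_idom order_less_asym order_less_irrefl)

lemma \<psi>_le_iff: "0 \<le> z \<Longrightarrow> 0 \<le> z' \<Longrightarrow> \<psi> z' \<le> \<psi> z \<longleftrightarrow> z \<le> z'"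
  using \<psi>_less_iff[of z' z] by (simp add: not_less[symmetric])

lemma \<psi>_pos: "0 \<le> z \<Longrightarrow> 0 < \<psi> z"
  using \<psi>_strict[of z "z + 1"] \<psi>_nonneg[of "z + 1"] by simp

lemma \<psi>_le_1: "0 \<le> z \<Longrightarrow> \<psi> z \<le> 1"
  using \<psi>_le_iff[of 0 z] \<psi>_0 by simp

lemma inj_\<psi>: "inj_on \<psi> {0..}"
  by (rule inj_onI) (metis \<psi>_le_iff antisym atLeast_iff order_refl)

lemma \<psi>_onto:
  assumes "0 < y" "y \<le> 1" obtains z where "0 \<le> z" "\<psi> z = y"
proof -
  have "eventually (\<lambda>z. \<psi> z < y \<and> 0 \<le> z) at_top"
    using order_tendstoD(2)[OF \<psi>_lim assms(1)] eventually_ge_at_top[of 0] by eventually_elim simp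
  then obtain b where b: "\<psi> b < y" "0 \<le> b"
    using eventually_happens'[OF trivial_limit_at_top_linorder] by blast
  have "\<exists>z\<ge>0. z \<le> b \<and> \<psi> z = y"
    using b assms by (intro IVT2') (auto simp: \<psi>_0 intro: continuous_on_subset[OF cont])
  then show ?thesis using that by blast
qed

text \<open>A real-valued stand-in for the pseudo-inverse. The default 0 keeps it nonnegative
  everywhere; at y = 0, where the pseudo-inverse is infinite, the copula vanishes and is treated
  separately.\<close>

definition \<phi> :: "real \<Rightarrow> real" where
  "\<phi> y = (if 0 < y \<and> y \<le> 1 then inv_into {0..} \<psi> y else 0)"

lemma \<phi>_\<psi> [simp]: "0 \<le> z \<Longrightarrow> \<phi> (\<psi> z) = z"
  using inj_\<psi> by (simp add: \<phi>_def \<psi>_pos \<psi>_le_1)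

lemma \<phi>_nonneg [simp]: "0 \<le> \<phi> y"
proof (cases "0 < y \<and> y \<le> 1")
  case True
  then show ?thesis using \<psi>_onto[of y] \<phi>_\<psi> by metis
qed (auto simp: \<phi>_def)

lemma \<psi>_\<phi> [simp]: "0 < y \<Longrightarrow> y \<le> 1 \<Longrightarrow> \<psi> (\<phi> y) = y"
  using \<psi>_onto[of y] \<phi>_\<psi> by metis

lemma \<phi>_pos: "0 < y \<Longrightarrow> y < 1 \<Longrightarrow> 0 < \<phi> y"
  by (metis \<phi>_nonneg \<psi>_0 \<psi>_\<phi> less_eq_real_def less_irrefl)

lemma \<psi>_le_iff_\<phi>: "0 < y \<Longrightarrow> y \<le> 1 \<Longrightarrow> 0 \<le> z \<Longrightarrow> \<psi> z \<le> y \<longleftrightarrow> \<phi> y \<le> z"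
  using \<psi>_le_iff[of "\<phi> y" z] by simp

lemma \<phi>_measurable [measurable]: "\<phi> \<in> borel_measurable borel"
proof -
  have "mono_on {0<..1} (\<lambda>y. - \<phi> y)"
    by (rule mono_onI) (metis \<phi>_nonneg \<psi>_\<phi> \<psi>_le_iff greaterThanAtMost_iff neg_le_iff_le)
  then have "(\<lambda>y. - \<phi> y) \<in> borel_measurable (restrict_space borel {0<..1})"
    by (rule borel_measurable_mono_on_fnc)
  then have "(\<lambda>y. indicator {0<..1} y *\<^sub>R - \<phi> y) \<in> borel_measurable borel"
    by (subst (asm) borel_measurable_restrict_space_iff) auto
  then have "(\<lambda>y. - (indicator {0<..1} y *\<^sub>R - \<phi> y)) \<in> borel_measurable borel"
    by measurable
  also have "(\<lambda>y. - (indicator {0<..1} y *\<^sub>R - \<phi> y)) = \<phi>"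
    by (auto simp: fun_eq_iff \<phi>_def indicator_def)
  finally show ?thesis .
qed

text \<open>Freezing the generator at its value 1 on the negative axis makes it continuous on the
  whole line, so arguments 1 / t - s need no sign condition for measurability.\<close>

definition \<psi>\<^sub>0 :: "real \<Rightarrow> real" where "\<psi>\<^sub>0 z = \<psi> (max 0 z)"

lemma \<psi>\<^sub>0_eq [simp]: "0 \<le> z \<Longrightarrow> \<psi>\<^sub>0 z = \<psi> z"
  by (simp add: \<psi>\<^sub>0_def)

lemma continuous_on_\<psi>\<^sub>0: "continuous_on A \<psi>\<^sub>0"
  unfolding \<psi>\<^sub>0_def by (intro continuous_on_compose2[OF cont] continuous_intros) auto

lemma \<psi>\<^sub>0_measurable [measurable]: "\<psi>\<^sub>0 \<in> borel_measurable borel"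
  by (rule borel_measurable_continuous_onI[OF continuous_on_\<psi>\<^sub>0])

lemma \<psi>\<^sub>0_range: "0 < \<psi>\<^sub>0 z" "\<psi>\<^sub>0 z \<le> 1"
  by (auto simp: \<psi>\<^sub>0_def \<psi>_pos \<psi>_le_1)

lemma negligible_\<phi>_image:
  assumes "negligible N" shows "negligible (\<phi> ` (N \<inter> {0<..1}))"
proof (rule negligible_locally_Lipschitz_image)
  show "negligible (N \<inter> {0<..1})" using assms by (rule negligible_subset) auto
  fix x assume "x \<in> N \<inter> {0<..1}"
  then have x: "0 < x" "x \<le> 1" by auto
  \<comment> \<open>All y > x / 2 in (0, 1] have preimages below \<open>\<phi> (x / 2)\<close>, so
    the lower slope bound on [0, b] covers a whole neighbourhood of x. Adding 1 makes b visibly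
    positive.\<close>
  define b where "b = \<phi> (x / 2) + 1"
  have "0 < b" by (simp add: b_def add_nonneg_pos)
  then obtain c where c: "0 < c"
    "\<And>z z'. 0 \<le> z \<Longrightarrow> z \<le> z' \<Longrightarrow> z' \<le> b \<Longrightarrow> c * (z' - z) \<le> \<psi> z - \<psi> z'"
    by (rule \<psi>_decrease_lower) blast
  have b: "\<phi> y \<le> b" if "x / 2 < y" "y \<le> 1" for y
    using that x \<psi>_le_iff_\<phi>[of y "\<phi> (x / 2)"] by (simp add: b_def)
  have dist: "\<bar>\<phi> y - \<phi> x\<bar> \<le> 1 / c * \<bar>y - x\<bar>" if y: "x / 2 < y" "y \<le> 1" for y
  proof -
    have "0 < y" using x y by simp
    then have "c * (\<phi> y - \<phi> x) \<le> x - y" if "\<phi> x \<le> \<phi> y"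
      using c(2)[of "\<phi> x" "\<phi> y"] that b[OF y] x y by simp
    moreover have "c * (\<phi> x - \<phi> y) \<le> y - x" if "\<phi> y \<le> \<phi> x"
      using c(2)[of "\<phi> y" "\<phi> x"] that b[of x] x y \<open>0 < y\<close> by simp
    ultimately have "c * \<bar>\<phi> y - \<phi> x\<bar> \<le> \<bar>y - x\<bar>"
      by (smt (verit))
    then show ?thesis using c(1) by (simp add: field_simps)
  qed
  show "\<exists>T B. open T \<and> x \<in> T \<and> (\<forall>y\<in>N \<inter> {0<..1} \<inter> T. norm (\<phi> y - \<phi> x) \<le> B * norm (y - x))"
    using dist x by (intro exI[of _ "{x / 2<..}"] exI[of _ "1 / c"]) auto
qed simp

text \<open>The upper slope bound with a = x / 2 is a Lipschitz estimate on the neighbourhood (x /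
  2, \<infinity>) of x; the origin is left out because no such bound is available there.\<close>

lemma negligible_\<psi>_image:
  assumes "negligible N" shows "negligible (\<psi> ` (N \<inter> {0<..}))"
proof (rule negligible_locally_Lipschitz_image)
  show "negligible (N \<inter> {0<..})" using assms by (rule negligible_subset) auto
  fix x assume "x \<in> N \<inter> {0<..}"
  then have x: "0 < x" by auto
  have dist: "\<bar>\<psi> y - \<psi> x\<bar> \<le> n / (x / 2) * \<bar>y - x\<bar>" if y: "x / 2 < y" for y
    using \<psi>_decrease_upper[of "x / 2" x y] \<psi>_decrease_upper[of "x / 2" y x]
      \<psi>_le_iff[of x y] \<psi>_le_iff[of y x] x y
    by (cases "x \<le> y") (auto simp: abs_if)
  show "\<exists>T B. open T \<and> x \<in> T \<and> (\<forall>y\<in>N \<inter> {0<..} \<inter> T. norm (\<psi> y - \<psi> x) \<le> B * norm (y - x))"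
    using dist x by (intro exI[of _ "{x / 2<..}"] exI[of _ "n / (x / 2)"]) auto
qed simp

subsection \<open>The conditional kernel\<close>

text \<open>The n-dimensional simplex of nonnegative points with coordinate sum at most 1 / t has
  volume 1 / (n! t^n). This is the density of its uniform law at a point with coordinate sum
  s.\<close>

definition weight :: "real \<Rightarrow> real \<Rightarrow> ennreal" where
  "weight s t = (if 0 < t \<and> t * s \<le> 1 then ennreal (fact n * t ^ n) else 0)"

lemma weight_measurable [measurable (raw)]:
  assumes [measurable]: "f \<in> borel_measurable M" "g \<in> borel_measurable M"
  shows "(\<lambda>x. weight (f x) (g x)) \<in> borel_measurable M"
  unfolding weight_def by measurable

text \<open>
  The conditional law, up to the factor \<open>emeasure (cond_kernel \<gamma> s) UNIV\<close>, of the last coordinate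
  given that the first coordinates satisfy $\sum_i \varphi(x_i) = s$.
\<close>
definition cond_kernel :: "real measure \<Rightarrow> real \<Rightarrow> real measure" where
  "cond_kernel \<sigma> s = distr (density \<sigma> (weight s)) borel (\<lambda>t. \<psi>\<^sub>0 (1 / t - s))"

lemma sets_cond_kernel [simp]: "sets (cond_kernel \<sigma> s) = sets borel"
  and space_cond_kernel [simp]: "space (cond_kernel \<sigma> s) = UNIV"
  by (auto simp: cond_kernel_def)

lemma emeasure_cond_kernel:
  assumes [measurable_cong]: "sets \<sigma> = sets borel" and [measurable]: "F \<in> sets borel"
  shows "emeasure (cond_kernel \<sigma> s) F = (\<integral>\<^sup>+t. weight s t * indicator F (\<psi>\<^sub>0 (1 / t - s)) \<partial>\<sigma>)"
proof -
  have "emeasure (cond_kernel \<sigma> s) F = (\<integral>\<^sup>+y. indicator F y \<partial>cond_kernel \<sigma> s)"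
    by simp
  also have "\<dots> = (\<integral>\<^sup>+t. weight s t * indicator F (\<psi>\<^sub>0 (1 / t - s)) \<partial>\<sigma>)"
    unfolding cond_kernel_def
    by (subst nn_integral_distr, measurable, subst nn_integral_density, measurable)
  finally show ?thesis .
qed

lemma cond_kernel_add:
  assumes [measurable_cong]: "sets A = sets borel" "sets D = sets borel" "sets S = sets borel"
    and sum: "\<And>X. X \<in> sets borel \<Longrightarrow> emeasure \<gamma> X = emeasure A X + emeasure D X + emeasure S X"
    and [measurable]: "F \<in> sets borel"
  shows "emeasure (cond_kernel \<gamma> s) F =
    emeasure (cond_kernel A s) F + emeasure (cond_kernel D s) F + emeasure (cond_kernel S s) F"
proof -
  \<comment> \<open>Additivity in the measure is given on sets only; induction over nonnegative
    measurable functions lifts it to integrals.\<close>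
  have int: "(\<integral>\<^sup>+t. f t \<partial>\<gamma>) = (\<integral>\<^sup>+t. f t \<partial>A) + (\<integral>\<^sup>+t. f t \<partial>D) + (\<integral>\<^sup>+t. f t \<partial>S)"
    if "f \<in> borel_measurable borel" for f :: "real \<Rightarrow> ennreal"
    using that
  proof (induction rule: borel_measurable_induct)
    case (cong f g)
    then show ?case by (metis UNIV_I ext space_borel)
  next
    case (set X)
    then show ?case using sum by (simp add: assms)
  next
    case (mult u c)
    then show ?case by (simp add: nn_integral_cmult distrib_left)
  next
    case (add u v)
    then show ?case by (simp add: nn_integral_add ac_simps)
  next
    case (seq U)
    have SUP_fun: "(SUP i. U i) = (\<lambda>t. SUP i. U i t)"
      by (simp add: fun_eq_iff image_comp)
    have sup: "integral\<^sup>N M (SUP i. U i) = (SUP i. integral\<^sup>N M (U i))"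
      if [measurable_cong]: "sets M = sets borel" for M :: "real measure"
    proof -
      have "U i \<in> borel_measurable M" for i
        using seq(1)[of i] by measurable
      then show ?thesis
        unfolding SUP_fun using seq(3) by (intro nn_integral_monotone_convergence_SUP) auto
    qed
    have incseq: "incseq (\<lambda>i. integral\<^sup>N M (U i))" for M :: "real measure"
      using seq(3) by (auto intro!: nn_integral_mono simp: incseq_def le_fun_def)
    have "incseq (\<lambda>i. integral\<^sup>N A (U i) + integral\<^sup>N D (U i))"
      using incseq[of A] incseq[of D] by (auto simp: incseq_def intro: add_mono)
    then show ?case
      unfolding sup[OF assms(1)] sup[OF assms(2)] sup[OF assms(3)] sup[OF sets_\<gamma>]
      by (simp only: seq ennreal_SUP_add[symmetric] incseq)
  qed
  show ?thesis
    by (simp add: emeasure_cond_kernel assms int)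
qed

text \<open>Since the weight vanishes for t > 1 / s, it is bounded by n! / s^n. For s = 0 the mass
  would be n! times the n-th moment, possibly infinite.\<close>

lemma finite_cond_kernel:
  assumes "finite_measure \<sigma>" and [measurable_cong]: "sets \<sigma> = sets borel" and s: "0 < s"
  shows "finite_measure (cond_kernel \<sigma> s)"
proof -
  interpret finite_measure \<sigma> by fact
  have "weight s t \<le> ennreal (fact n * (1 / s) ^ n)" for t
  proof (cases "0 < t \<and> t * s \<le> 1")
    case True
    then have "t \<le> 1 / s" using s by (simp add: field_simps)
    then show ?thesis
      using True by (auto simp: weight_def simp del: power_one_over intro!: ennreal_leI mult_left_mono power_mono)
  qed (auto simp: weight_def)
  then have "(\<integral>\<^sup>+t. weight s t \<partial>\<sigma>) \<le> (\<integral>\<^sup>+t. ennreal (fact n * (1 / s) ^ n) \<partial>\<sigma>)"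
    by (intro nn_integral_mono)
  also have "\<dots> < \<infinity>"
    by (simp add: ennreal_mult_eq_top_iff emeasure_finite less_top[symmetric])
  finally show ?thesis
    by (intro finite_measureI) (simp add: emeasure_cond_kernel assms less_top)
qed

text \<open>Reduces the transport of all three parts to one task: trap the admissible preimages of
  F, those t with positive weight, in a null set of the original measure.\<close>

lemma cond_kernel_eq_0:
  assumes [measurable_cong]: "sets \<sigma> = sets borel" and [measurable]: "F \<in> sets borel" and X: "X \<in> null_sets \<sigma>"
    and sub: "\<And>t. 0 < t \<Longrightarrow> t * s \<le> 1 \<Longrightarrow> \<psi>\<^sub>0 (1 / t - s) \<in> F \<Longrightarrow> t \<in> X"
  shows "emeasure (cond_kernel \<sigma> s) F = 0"
proof -
  have "AE t in \<sigma>. weight s t * indicator F (\<psi>\<^sub>0 (1 / t - s)) = 0"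
    using AE_not_in[OF X] by eventually_elim (use sub in \<open>auto simp: weight_def indicator_def\<close>)
  then show ?thesis
    by (simp only: emeasure_cond_kernel[OF assms(1,2)]) (subst nn_integral_0_iff_AE, measurable)
qed

text \<open>The map y \<mapsto> \<open>1 / (\<phi> y + s)\<close> recovers the parameter t; this
  gives injectivity and lets preimages be computed as images.\<close>

lemma cond_kernel_param:
  assumes "0 < t" "t * s \<le> 1" "0 \<le> s"
  shows "0 \<le> 1 / t - s" "\<phi> (\<psi>\<^sub>0 (1 / t - s)) = 1 / t - s" "t = 1 / (\<phi> (\<psi>\<^sub>0 (1 / t - s)) + s)"
proof -
  show nonneg: "0 \<le> 1 / t - s" using assms by (simp add: field_simps)
  then show "\<phi> (\<psi>\<^sub>0 (1 / t - s)) = 1 / t - s" by simp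
  then show "t = 1 / (\<phi> (\<psi>\<^sub>0 (1 / t - s)) + s)" using assms by simp
qed

text \<open>The preimage of a null set N is the image of N under \<open>\<phi>\<close> followed by w
  \<mapsto> \<open>1 / (w + s)\<close>. The first map is locally Lipschitz by the lower slope bound,
  the second is differentiable because w \<ge> 0 and s > 0.\<close>

lemma absolutely_continuous_cond_kernel:
  assumes sets: "sets \<sigma> = sets borel" and abs: "absolutely_continuous lborel \<sigma>" and s: "0 < s"
  shows "absolutely_continuous lborel (cond_kernel \<sigma> s)"
  unfolding absolutely_continuous_def
proof
  fix N :: "real set" assume N: "N \<in> null_sets lborel"
  then have "negligible N"
    by (simp add: negligible_iff_null_sets null_sets_completionI)
  then have "negligible (\<phi> ` (N \<inter> {0<..1}))" by (rule negligible_\<phi>_image)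
  then have "negligible ((\<lambda>w. 1 / (w + s)) ` \<phi> ` (N \<inter> {0<..1}))"
  proof (rule negligible_differentiable_image_negligible[rotated])
    show "(\<lambda>w. 1 / (w + s)) differentiable_on \<phi> ` (N \<inter> {0<..1})"
      unfolding differentiable_on_def using s
      by (intro ballI differentiable_divide differentiable_const differentiable_add differentiable_ident)
        (auto simp: add_nonneg_eq_0_iff)
  qed simp
  then obtain X where X: "X \<in> null_sets lborel" "(\<lambda>w. 1 / (w + s)) ` \<phi> ` (N \<inter> {0<..1}) \<subseteq> X"
    by (rule null_sets_lborel_superset)
  have "emeasure (cond_kernel \<sigma> s) N = 0"
  proof (rule cond_kernel_eq_0[OF sets])
    show "X \<in> null_sets \<sigma>" using X(1) abs by (auto simp: absolutely_continuous_def)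
    fix t assume t: "0 < t" "t * s \<le> 1" "\<psi>\<^sub>0 (1 / t - s) \<in> N"
    have "1 / (\<phi> (\<psi>\<^sub>0 (1 / t - s)) + s) \<in> X"
      using X(2) t(3) \<psi>\<^sub>0_range by auto
    then show "t \<in> X" using cond_kernel_param(3)[OF t(1,2)] s by simp
  qed (use N in auto)
  then show "N \<in> null_sets (cond_kernel \<sigma> s)" using N by (auto simp: null_sets_def)
qed

lemma discrete_cond_kernel:
  assumes sets: "sets \<sigma> = sets borel" and dis: "discrete_measure \<sigma>"
  shows "discrete_measure (cond_kernel \<sigma> s)"
proof -
  obtain P where P: "countable P" "emeasure \<sigma> (- P) = 0"
    using dis by (auto simp: discrete_measure_def)
  let ?Q = "(\<lambda>t. \<psi>\<^sub>0 (1 / t - s)) ` P"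
  have borel: "P \<in> sets borel" "?Q \<in> sets borel"
    using P(1) by (auto intro: sets.countable)
  have "emeasure (cond_kernel \<sigma> s) (- ?Q) = 0"
    by (rule cond_kernel_eq_0[OF sets, of _ "- P"])
      (use P borel sets in \<open>auto intro!: borel_comp simp: null_sets_def\<close>)
  then show ?thesis using P(1) by (auto simp: discrete_measure_def)
qed

text \<open>Injectivity rules out atoms. The null carrier is pushed forward by t \<mapsto> 1 / t - s
  and then by \<open>\<psi>\<close>, which preserves null sets by the upper slope bound.\<close>

lemma singular_cond_kernel:
  assumes sets: "sets \<sigma> = sets borel" and sing: "singular_measure \<sigma>" and s: "0 < s"
  shows "singular_measure (cond_kernel \<sigma> s)"
proof -
  obtain N where N: "N \<in> null_sets lborel" "emeasure \<sigma> (- N) = 0"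
    using sing by (auto simp: singular_measure_def)
  have point: "{t} \<in> null_sets \<sigma>" for t
    using sing sets by (auto simp: singular_measure_def null_sets_def)
  have no_atoms: "emeasure (cond_kernel \<sigma> s) {y} = 0" for y
  proof (rule cond_kernel_eq_0[OF sets _ point])
    show "t \<in> {1 / (\<phi> y + s)}" if "0 < t" "t * s \<le> 1" "\<psi>\<^sub>0 (1 / t - s) \<in> {y}" for t
      using cond_kernel_param(3)[OF that(1,2)] s that(3) by simp
  qed auto
  have "negligible N"
    using N(1) by (simp add: negligible_iff_null_sets null_sets_completionI)
  then have "negligible (N \<inter> {0<..<1 / s})"
    by (rule negligible_subset) auto
  then have "negligible ((\<lambda>t. 1 / t - s) ` (N \<inter> {0<..<1 / s}))"
  proof (rule negligible_differentiable_image_negligible[rotated])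
    show "(\<lambda>t. 1 / t - s) differentiable_on N \<inter> {0<..<1 / s}"
      unfolding differentiable_on_def
      by (intro ballI differentiable_divide differentiable_const differentiable_diff differentiable_ident) auto
  qed simp
  then have "negligible (\<psi> ` ((\<lambda>t. 1 / t - s) ` (N \<inter> {0<..<1 / s}) \<inter> {0<..}))"
    by (rule negligible_\<psi>_image)
  then obtain X where X: "X \<in> null_sets lborel"
    "\<psi> ` ((\<lambda>t. 1 / t - s) ` (N \<inter> {0<..<1 / s}) \<inter> {0<..}) \<subseteq> X"
    by (rule null_sets_lborel_superset)
  \<comment> \<open>The endpoint t = 1 / s is sent to 0 and hence to the value 1, which the
    Lipschitz argument on the open interval misses; so 1 is added to the carrier by hand.\<close>
  have "emeasure (cond_kernel \<sigma> s) (- insert 1 X) = 0"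
  proof (rule cond_kernel_eq_0[OF sets])
    show "- N \<in> null_sets \<sigma>" using N sets by (auto simp: null_sets_def intro: borel_comp)
    show "- insert 1 X \<in> sets borel" using X(1) by (intro borel_comp) auto
    fix t assume t: "0 < t" "t * s \<le> 1" "\<psi>\<^sub>0 (1 / t - s) \<in> - insert 1 X"
    have nonneg: "0 \<le> 1 / t - s" using cond_kernel_param(1)[OF t(1,2)] s by simp
    moreover have "1 / t - s \<noteq> 0" using t(3) nonneg \<psi>_0 by auto
    ultimately have pos: "0 < 1 / t - s" by simp
    then have "t < 1 / s" using t(1) s by (simp add: field_simps)
    show "t \<in> - N"
    proof
      assume "t \<in> N"
      then have "\<psi> (1 / t - s) \<in> X"
        using X(2) pos t(1) \<open>t < 1 / s\<close> by (auto simp: image_subset_iff)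
      then show False using t(3) nonneg by simp
    qed
  qed
  moreover have "{1} \<union> X \<in> null_sets lborel"
    using X(1) by (intro null_sets.Un) (auto simp: null_sets_def)
  ultimately show ?thesis using no_atoms by (auto simp: singular_measure_def)
qed

lemma lebesgue_decomposition_cond_kernel:
  assumes dec: "lebesgue_decomposition \<gamma> A D S" and s: "0 < s"
  shows "lebesgue_decomposition (cond_kernel \<gamma> s) (cond_kernel A s) (cond_kernel D s) (cond_kernel S s)"
proof -
  have sets: "sets A = sets borel" "sets D = sets borel" "sets S = sets borel"
    using dec by (auto simp: lebesgue_decomposition_def)
  have "\<And>X. X \<in> sets borel \<Longrightarrow> emeasure \<gamma> X = emeasure A X + emeasure D X + emeasure S X"
    using dec by (auto simp: lebesgue_decomposition_def)
  note add = cond_kernel_add[OF sets this]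
  show ?thesis
    using dec s unfolding lebesgue_decomposition_def
    by (auto simp: add intro: finite_cond_kernel absolutely_continuous_cond_kernel
        discrete_cond_kernel singular_cond_kernel)
qed

text \<open>The preimage of F inside (0, 1 / s) is open, and it is nonempty because it contains
  \<open>1 / (\<phi> y + s)\<close> for any y in F. The support hypothesis gives it mass, and the
  weight is positive on it.\<close>

lemma cond_kernel_pos:
  assumes [measurable_cong]: "sets \<sigma> = sets borel" and supp: "measure_support \<sigma> = {0..}" and s: "0 < s"
    and F: "open F" "F \<noteq> {}" "F \<subseteq> {0<..<1}"
  shows "0 < emeasure (cond_kernel \<sigma> s) F"
proof (rule ccontr)
  have [simp]: "space \<sigma> = UNIV" using sets_eq_imp_space_eq[OF assms(1)] by simp
  have [measurable]: "F \<in> sets borel" using F(1) by simp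
  define U where "U = (\<lambda>t. \<psi>\<^sub>0 (1 / t - s)) -` F \<inter> {0<..<1 / s}"
  have "continuous_on {0<..<1 / s} (\<lambda>t. \<psi>\<^sub>0 (1 / t - s))"
    by (intro continuous_on_compose2[OF continuous_on_\<psi>\<^sub>0[of UNIV]] continuous_intros) auto
  then have U: "open U" using F(1) unfolding U_def by (subst (asm) continuous_on_open_vimage) auto
  obtain y where y: "y \<in> F" "0 < y" "y < 1" using F by force
  have \<phi>y: "0 < \<phi> y" using y by (intro \<phi>_pos)
  then have "1 / (\<phi> y + s) \<in> U"
    using y s by (auto simp: U_def field_simps)
  moreover have "1 / (\<phi> y + s) \<in> {0..}" using \<phi>y s by simp
  ultimately have pos: "0 < emeasure \<sigma> U"
    by (intro measure_support_emeasure_pos[OF supp U]) auto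
  assume "\<not> 0 < emeasure (cond_kernel \<sigma> s) F"
  then have "AE t in \<sigma>. weight s t * indicator F (\<psi>\<^sub>0 (1 / t - s)) = 0"
    by (simp add: emeasure_cond_kernel assms nn_integral_0_iff_AE)
  then have "AE t in \<sigma>. t \<notin> U"
    by eventually_elim (use s in \<open>auto simp: U_def weight_def indicator_def field_simps split: if_splits\<close>)
  then have "emeasure \<sigma> U = 0"
    by (subst (asm) AE_iff_measurable[of U]) (use U in auto)
  then show False using pos by simp
qed

lemma cond_kernel_mass_pos:
  assumes s: "0 < s" shows "0 < emeasure (cond_kernel \<gamma> s) UNIV"
proof (rule ccontr)
  assume "\<not> 0 < emeasure (cond_kernel \<gamma> s) UNIV"
  then have "AE t in \<gamma>. weight s t = 0"
    by (simp add: emeasure_cond_kernel nn_integral_0_iff_AE)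
  then have "AE t in \<gamma>. t \<notin> {0<..<1 / s}"
    by eventually_elim (use s in \<open>auto simp: weight_def field_simps split: if_splits\<close>)
  then have "emeasure \<gamma> {0<..<1 / s} = 0"
    by (subst (asm) AE_iff_measurable[of "{0<..<1 / s}"]) auto
  then show False using \<gamma>_pos[of "1 / s"] s by simp
qed

lemma cond_kernel_mass_finite: "0 < s \<Longrightarrow> emeasure (cond_kernel \<gamma> s) F < \<infinity>"
  using finite_measure.emeasure_finite[OF finite_cond_kernel[OF \<gamma>.finite_measure_axioms sets_\<gamma>], of s F]
  by (simp add: less_top)

lemma cond_kernel_measurable [measurable (raw)]:
  assumes "finite_measure \<sigma>" and [measurable_cong]: "sets \<sigma> = sets borel"
    and [measurable]: "F \<in> sets borel" "f \<in> borel_measurable M"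
  shows "(\<lambda>x. emeasure (cond_kernel \<sigma> (f x)) F) \<in> borel_measurable M"
proof -
  interpret finite_measure \<sigma> by fact
  have "(\<lambda>s. emeasure (cond_kernel \<sigma> s) F) \<in> borel_measurable borel"
    unfolding emeasure_cond_kernel[OF assms(2,3)] by measurable
  then show ?thesis by (rule measurable_compose[rotated]) simp
qed

subsection \<open>The copula measure\<close>

lemma pseudo_inverse_pos:
  assumes "0 < y" "y \<le> 1" shows "pseudo_inverse \<psi> y = ennreal (\<phi> y)"
proof -
  have "{z. extend_generator \<psi> z = y} = {ennreal (\<phi> y)}"
  proof (intro equalityI subsetI)
    fix z assume "z \<in> {z. extend_generator \<psi> z = y}"
    then have "z \<noteq> \<infinity>" "\<psi> (enn2real z) = y"
      using tendsto_Lim[OF trivial_limit_at_top_linorder \<psi>_lim] assms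
      by (auto simp: extend_generator_def split: if_splits)
    then show "z \<in> {ennreal (\<phi> y)}"
      using \<phi>_\<psi>[of "enn2real z"] by (cases z) auto
  qed (use assms in \<open>simp add: extend_generator_def\<close>)
  then show ?thesis by (simp add: pseudo_inverse_def)
qed

text \<open>The generator has no finite zero, so 0 is attained only at infinity.\<close>

lemma pseudo_inverse_0: "pseudo_inverse \<psi> 0 = \<infinity>"
proof -
  have "extend_generator \<psi> z \<noteq> 0" if "z \<noteq> \<infinity>" for z
    using that \<psi>_pos[of "enn2real z"] by (auto simp: extend_generator_def)
  then have "{z. extend_generator \<psi> z = 0} \<subseteq> {\<infinity>}" by auto
  then have "\<infinity> \<le> Inf {z. extend_generator \<psi> z = 0}"
    by (intro Inf_greatest) auto
  then show ?thesis by (simp add: pseudo_inverse_def top_unique)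
qed

lemma archimedean_function_pos:
  assumes "\<And>i. 0 < u $ i" "u \<le> 1" "0 < v" "v \<le> 1"
  shows "archimedean_function \<psi> (u, v) = \<psi> ((\<Sum>i\<in>UNIV. \<phi> (u $ i)) + \<phi> v)"
proof -
  have "(\<Sum>i\<in>UNIV. pseudo_inverse \<psi> (u $ i)) + pseudo_inverse \<psi> v =
      ennreal ((\<Sum>i\<in>UNIV. \<phi> (u $ i)) + \<phi> v)"
    using assms by (simp add: pseudo_inverse_pos less_eq_vec_def sum_ennreal ennreal_plus sum_nonneg)
  then have "archimedean_function \<psi> (u, v) =
      extend_generator \<psi> (ennreal ((\<Sum>i\<in>UNIV. \<phi> (u $ i)) + \<phi> v))"
    by (simp only: archimedean_function_def prod.case)
  then show ?thesis
    by (simp del: ennreal_plus add: extend_generator_def sum_nonneg)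
qed

lemma archimedean_function_0:
  assumes "u $ i = 0 \<or> v = 0"
  shows "archimedean_function \<psi> (u, v) = 0"
proof -
  have "(\<Sum>i\<in>UNIV. pseudo_inverse \<psi> (u $ i)) + pseudo_inverse \<psi> v = \<infinity>"
    using assms pseudo_inverse_0 by (auto intro!: exI[of _ i])
  then show ?thesis
    using tendsto_Lim[OF trivial_limit_at_top_linorder \<psi>_lim]
    by (simp add: archimedean_function_def extend_generator_def)
qed

section \<open>Passing between the cube and the nonnegative orthant\<close>

definition \<psi>_vec :: "real^'n \<Rightarrow> real^'n" where
  "\<psi>_vec z = (\<chi> i. \<psi>\<^sub>0 (z $ i))"

definition \<phi>_sum :: "real^'n \<Rightarrow> real" where
  "\<phi>_sum u = (\<Sum>i\<in>UNIV. \<phi> (u $ i))"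

lemma continuous_on_\<psi>_vec: "continuous_on A (\<psi>_vec :: real^'n \<Rightarrow> _)"
  unfolding \<psi>_vec_def
  by (intro continuous_on_vec_lambda continuous_on_compose2[OF continuous_on_\<psi>\<^sub>0[of UNIV]] continuous_intros) auto

lemma \<psi>_vec_measurable [measurable]: "(\<psi>_vec :: real^'n \<Rightarrow> _) \<in> borel_measurable borel"
  by (rule borel_measurable_continuous_onI[OF continuous_on_\<psi>_vec])

lemma \<phi>_sum_measurable [measurable]: "(\<phi>_sum :: real^'n \<Rightarrow> _) \<in> borel_measurable borel"
  unfolding \<phi>_sum_def by measurable

lemma \<phi>_sum_\<psi>_vec: "0 \<le> z \<Longrightarrow> \<phi>_sum (\<psi>_vec z) = (\<Sum>i\<in>UNIV. z $ i)"
  by (simp add: \<phi>_sum_def \<psi>_vec_def less_eq_vec_def)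

lemma \<psi>_vec_in_cube [simp]: "0 \<le> \<psi>_vec z" "\<psi>_vec z \<le> 1"
  using \<psi>\<^sub>0_range by (auto simp: \<psi>_vec_def less_eq_vec_def intro: less_imp_le)

text \<open>
  The law of $(\psi(R S_1), \dots, \psi(R S_d))$ with $1/R$ distributed as \<open>\<gamma>\<close> and $S$ uniform on
  the unit simplex $\{S \ge 0, \sum_i S_i = 1\}$: given $1/R = t$, the vector of the first $d-1$
  coordinates of $RS$ has density $(d-1)!\, t^{d-1}$ on $\{z \ge 0, \sum_i z_i \le 1/t\}$.
\<close>
definition copula_measure :: "((real^'n) \<times> real) measure" where
  "copula_measure = distr
     (density (lborel \<Otimes>\<^sub>M \<gamma>) (\<lambda>(z, t). indicator {0..} z * weight (\<Sum>i\<in>UNIV. z $ i) t))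
     borel (\<lambda>(z, t). (\<psi>_vec z, \<psi>\<^sub>0 (1 / t - (\<Sum>i\<in>UNIV. z $ i))))"

lemma sets_lborel_\<gamma> [measurable_cong]:
  "sets ((lborel :: (real^'n) measure) \<Otimes>\<^sub>M \<gamma>) = sets (borel \<Otimes>\<^sub>M borel)"
  by (intro sets_pair_measure_cong) auto

text \<open>Written with projections instead of a pattern, so that it fits both orders of
  integration.\<close>

lemma copula_density_measurable:
  assumes [measurable]: "E \<in> sets borel" "F \<in> sets borel"
  shows "(\<lambda>p. indicator {0..} (fst p) * weight (\<Sum>i\<in>UNIV. fst p $ i) (snd p) *
      indicator E (\<psi>_vec (fst p)) * indicator F (\<psi>\<^sub>0 (1 / snd p - (\<Sum>i\<in>UNIV. fst p $ i))))
    \<in> borel_measurable ((lborel :: (real^'n) measure) \<Otimes>\<^sub>M \<gamma>)"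
  by measurable

lemma emeasure_copula_measure:
  assumes [measurable]: "E \<in> sets borel" "F \<in> sets borel"
  shows "emeasure (copula_measure :: ((real^'n) \<times> real) measure) (E \<times> F) =
    (\<integral>\<^sup>+p. indicator {0..} (fst p) * weight (\<Sum>i\<in>UNIV. fst p $ i) (snd p) *
      indicator E (\<psi>_vec (fst p)) * indicator F (\<psi>\<^sub>0 (1 / snd p - (\<Sum>i\<in>UNIV. fst p $ i)))
     \<partial>(lborel \<Otimes>\<^sub>M \<gamma>))"
proof -
  have "E \<times> F \<in> sets borel" by (subst borel_prod[symmetric]) simp
  then have "emeasure (copula_measure :: ((real^'n) \<times> real) measure) (E \<times> F) =
      (\<integral>\<^sup>+q. indicator (E \<times> F) q \<partial>copula_measure)"
    by (simp add: copula_measure_def)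
  also have "\<dots> = (\<integral>\<^sup>+p. (case p of (z, t) \<Rightarrow> indicator {0..} z * weight (\<Sum>i\<in>UNIV. z $ i) t) *
      indicator (E \<times> F) (case p of (z, t) \<Rightarrow> (\<psi>_vec z, \<psi>\<^sub>0 (1 / t - (\<Sum>i\<in>UNIV. z $ i))))
     \<partial>(lborel \<Otimes>\<^sub>M \<gamma>))"
    using \<open>E \<times> F \<in> sets borel\<close> unfolding copula_measure_def
    by (subst nn_integral_distr, measurable, subst nn_integral_density, measurable)
  also have "\<dots> = (\<integral>\<^sup>+p. indicator {0..} (fst p) * weight (\<Sum>i\<in>UNIV. fst p $ i) (snd p) *
      indicator E (\<psi>_vec (fst p)) * indicator F (\<psi>\<^sub>0 (1 / snd p - (\<Sum>i\<in>UNIV. fst p $ i)))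
     \<partial>(lborel \<Otimes>\<^sub>M \<gamma>))"
    by (intro nn_integral_cong) (auto simp: indicator_times mult.assoc)
  finally show ?thesis .
qed

text \<open>Integrating over t on the inside disintegrates the law along its first coordinates; the
  opposite order will give the distribution function.\<close>

lemma emeasure_copula_measure_kernel:
  assumes [measurable]: "E \<in> sets borel" "F \<in> sets borel"
  shows "emeasure (copula_measure :: ((real^'n) \<times> real) measure) (E \<times> F) =
    (\<integral>\<^sup>+z. indicator {0..} z * indicator E (\<psi>_vec z) *
      emeasure (cond_kernel \<gamma> (\<Sum>i\<in>UNIV. z $ i)) F \<partial>lborel)"
proof -
  have "emeasure (copula_measure :: ((real^'n) \<times> real) measure) (E \<times> F) =
    (\<integral>\<^sup>+z. \<integral>\<^sup>+t. indicator {0..} z * weight (\<Sum>i\<in>UNIV. z $ i) t *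
      indicator E (\<psi>_vec z) * indicator F (\<psi>\<^sub>0 (1 / t - (\<Sum>i\<in>UNIV. z $ i))) \<partial>\<gamma> \<partial>lborel)"
    unfolding emeasure_copula_measure[OF assms]
    by (subst \<gamma>.nn_integral_fst[OF copula_density_measurable[OF assms], symmetric]) simp
  also have "\<dots> = (\<integral>\<^sup>+z. indicator {0..} z * indicator E (\<psi>_vec z) *
      emeasure (cond_kernel \<gamma> (\<Sum>i\<in>UNIV. z $ i)) F \<partial>lborel)"
    by (subst emeasure_cond_kernel[OF sets_\<gamma> assms(2)], subst nn_integral_cmult[symmetric], measurable)
      (simp add: ac_simps)
  finally show ?thesis .
qed

text \<open>For fixed t the event says that each z_i is at least \<open>\<phi> (u $ i)\<close> and
  the coordinate sum is at most 1 / t - \<open>\<phi> v\<close>: a corner simplex. Its volume times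
  n! t^n is (1 - t s)_+^n, with s the sum of all \<open>\<phi>\<close> values, and integrating over
  \<open>\<gamma>\<close> returns the generator at s.\<close>

lemma copula_measure_cdf_pos:
  fixes u :: "real^'n"
  assumes n: "CARD('n) = n" and u: "\<And>i. 0 < u $ i" "u \<le> 1" and v: "0 < v" "v \<le> 1"
  shows "emeasure copula_measure ({..u} \<times> {..v}) = ennreal (\<psi> ((\<Sum>i\<in>UNIV. \<phi> (u $ i)) + \<phi> v))"
proof -
  interpret pair_sigma_finite "lborel :: (real^'n) measure" \<gamma> ..
  let ?a = "(\<chi> i. \<phi> (u $ i)) :: real^'n"
  let ?s = "(\<Sum>i\<in>UNIV. \<phi> (u $ i)) + \<phi> v"
  have borel: "{..u} \<in> sets borel" "{..v} \<in> sets borel" by auto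
  have s: "0 \<le> ?s" by (intro add_nonneg_nonneg sum_nonneg) auto
  have slice: "(\<integral>\<^sup>+z. indicator {0..} z * weight (\<Sum>i\<in>UNIV. z $ i) t * indicator {..u} (\<psi>_vec z) *
        indicator {..v} (\<psi>\<^sub>0 (1 / t - (\<Sum>i\<in>UNIV. z $ i))) \<partial>lborel) =
      indicator {0<..} t * ennreal ((max 0 (1 - t * ?s)) ^ n)" for t
  proof (cases "0 < t")
    case True
    let ?X = "{z::real^'n. (\<forall>i. ?a $ i \<le> z $ i) \<and> (\<Sum>i\<in>UNIV. z $ i) \<le> 1 / t - \<phi> v}"
    have X: "?X \<in> sets borel" by measurable
    have X_iff: "z \<in> ?X \<longleftrightarrow> 0 \<le> z \<and> t * (\<Sum>i\<in>UNIV. z $ i) \<le> 1 \<and> \<psi>_vec z \<le> u \<and>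
        \<psi>\<^sub>0 (1 / t - (\<Sum>i\<in>UNIV. z $ i)) \<le> v" for z
    proof (cases "0 \<le> z \<and> t * (\<Sum>i\<in>UNIV. z $ i) \<le> 1")
      case in_simplex: True
      then have "(\<Sum>i\<in>UNIV. z $ i) \<le> 1 / t" using True by (simp add: field_simps)
      then have "\<psi>\<^sub>0 (1 / t - (\<Sum>i\<in>UNIV. z $ i)) \<le> v \<longleftrightarrow> \<phi> v \<le> 1 / t - (\<Sum>i\<in>UNIV. z $ i)"
        using v by (simp add: \<psi>_le_iff_\<phi>)
      moreover have "\<psi>\<^sub>0 (z $ i) \<le> u $ i \<longleftrightarrow> \<phi> (u $ i) \<le> z $ i" for i
        using in_simplex u by (simp add: \<psi>_le_iff_\<phi> less_eq_vec_def)
      then have "\<psi>_vec z \<le> u \<longleftrightarrow> (\<forall>i. ?a $ i \<le> z $ i)"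
        by (simp add: \<psi>_vec_def less_eq_vec_def)
      ultimately show ?thesis using in_simplex by auto
    next
      case False
      \<comment> \<open>Since \<open>\<phi>\<close> is nonnegative, the corner simplex lies inside
        the simplex where the weight is positive.\<close>
      have False if z: "z \<in> ?X"
      proof -
        have "0 \<le> z $ i" for i
          using z order_trans[OF \<phi>_nonneg[of "u $ i"], of "z $ i"] by simp
        moreover have "(\<Sum>i\<in>UNIV. z $ i) \<le> 1 / t"
          using z \<phi>_nonneg[of v] unfolding mem_Collect_eq by linarith
        then have "t * (\<Sum>i\<in>UNIV. z $ i) \<le> 1" using True by (simp add: field_simps)
        ultimately show False using False by (simp add: less_eq_vec_def)
      qed
      then show ?thesis using False by blast
    qed
    have "(\<integral>\<^sup>+z. indicator {0..} z * weight (\<Sum>i\<in>UNIV. z $ i) t * indicator {..u} (\<psi>_vec z) *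
        indicator {..v} (\<psi>\<^sub>0 (1 / t - (\<Sum>i\<in>UNIV. z $ i))) \<partial>lborel) =
        (\<integral>\<^sup>+z. ennreal (fact n * t ^ n) * indicator ?X z \<partial>lborel)"
    proof (intro nn_integral_cong)
      fix z :: "real^'n"
      show "indicator {0..} z * weight (\<Sum>i\<in>UNIV. z $ i) t * indicator {..u} (\<psi>_vec z) *
        indicator {..v} (\<psi>\<^sub>0 (1 / t - (\<Sum>i\<in>UNIV. z $ i))) = ennreal (fact n * t ^ n) * indicator ?X z"
        using X_iff[of z] True by (simp only: indicator_def weight_def) (auto simp: mult_ac)
    qed
    also have "\<dots> = ennreal (fact n * t ^ n) * emeasure lborel ?X"
      using X by (simp add: nn_integral_cmult_indicator)
    also have "emeasure lborel ?X = ennreal (max 0 (1 / t - ?s) ^ n / fact n)"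
      unfolding emeasure_lborel_corner_simplex by (simp add: n algebra_simps)
    also have "ennreal (fact n * t ^ n) * ennreal (max 0 (1 / t - ?s) ^ n / fact n) =
        ennreal ((t * max 0 (1 / t - ?s)) ^ n)"
      using True by (simp add: ennreal_mult[symmetric] power_mult_distrib)
    also have "t * max 0 (1 / t - ?s) = max 0 (1 - t * ?s)"
      using True by (simp add: max_def field_simps)
    finally show ?thesis using True by simp
  qed (simp add: weight_def)
  have "emeasure copula_measure ({..u} \<times> {..v}) =
    (\<integral>\<^sup>+t. \<integral>\<^sup>+z. indicator {0..} z * weight (\<Sum>i\<in>UNIV. z $ i) t *
      indicator {..u} (\<psi>_vec z) * indicator {..v} (\<psi>\<^sub>0 (1 / t - (\<Sum>i\<in>UNIV. z $ i))) \<partial>lborel \<partial>\<gamma>)"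
    unfolding emeasure_copula_measure[OF borel]
    by (subst nn_integral_snd[OF copula_density_measurable[OF borel], symmetric]) simp
  also have "\<dots> = ennreal (\<psi> ?s)"
    unfolding slice \<psi>_nn_integral[OF s] by simp
  finally show ?thesis .
qed

lemma copula_measure_has_distribution_function:
  assumes n: "CARD('n) = n"
    and C: "\<And>p. p \<in> unit_cube \<Longrightarrow> C p = archimedean_function \<psi> p"
  shows "has_distribution_function (copula_measure :: ((real^'n) \<times> real) measure) C"
proof -
  let ?M = "copula_measure :: ((real^'n) \<times> real) measure"
  have sets: "sets ?M = sets borel" by (simp add: copula_measure_def)
  have space: "space ?M = UNIV" using sets_eq_imp_space_eq[OF sets] by simp
  have range: "emeasure ?M (E \<times> F) = emeasure ?M ((E \<inter> {..1}) \<times> (F \<inter> {..1}))"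
    if "E \<in> sets borel" "F \<in> sets borel" for E :: "(real^'n) set" and F
    using that \<psi>_vec_in_cube \<psi>\<^sub>0_range
    by (subst (1 2) emeasure_copula_measure) (auto simp: indicator_def)
  \<comment> \<open>All \<open>\<phi>\<close> values vanish at the upper corner of the cube, so the
    total mass is \<open>\<psi> 0\<close>.\<close>
  have one: "emeasure ?M ({..1} \<times> {..1}) = 1"
    using copula_measure_cdf_pos[OF n, of 1 1] \<phi>_\<psi>[of 0] \<psi>_0 by simp
  have "emeasure ?M UNIV = emeasure ?M ({..1} \<times> {..1})"
    using range[of UNIV UNIV] by simp
  with one have prob: "prob_space ?M" by (intro prob_spaceI) (simp add: space)
  interpret M: prob_space ?M by fact
  have cube: "emeasure ?M (- unit_cube) = 0"
  proof -
    have "emeasure ?M unit_cube = emeasure ?M (UNIV \<times> UNIV)"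
      unfolding unit_cube_def using \<psi>_vec_in_cube \<psi>\<^sub>0_range
      by (subst (1 2) emeasure_copula_measure) (auto simp: indicator_def less_imp_le)
    moreover have "emeasure ?M (UNIV \<times> UNIV) = 1"
      using M.emeasure_space_1 by (simp add: space)
    moreover have "unit_cube \<in> sets ?M" by (simp add: sets borel_closed closed_unit_cube)
    ultimately have "AE p in ?M. p \<in> unit_cube"
      by (subst M.AE_in_set_eq_1) (simp_all add: M.emeasure_eq_measure)
    then show ?thesis
      using \<open>unit_cube \<in> sets ?M\<close> by (subst (asm) AE_iff_measurable[of "- unit_cube"])
        (auto simp: space sets intro: borel_comp)
  qed
  have "measure ?M ({..u} \<times> {..v}) = C (u, v)" if uv: "(u, v) \<in> unit_cube" for u v
  proof (cases "(\<forall>i. u $ i \<noteq> 0) \<and> v \<noteq> 0")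
    case True
    have range_uv: "\<And>i. 0 \<le> u $ i" "u \<le> 1" "0 \<le> v" "v \<le> 1"
      using uv by (auto simp: unit_cube_def less_eq_vec_def)
    then have pos: "\<And>i. 0 < u $ i" "0 < v" using True by (auto simp: order_less_le)
    have "emeasure ?M ({..u} \<times> {..v}) = ennreal (C (u, v))"
      using pos range_uv C[OF uv] by (simp add: copula_measure_cdf_pos[OF n] archimedean_function_pos)
    moreover have "0 \<le> C (u, v)"
      using pos range_uv C[OF uv] by (simp add: archimedean_function_pos \<psi>_nonneg sum_nonneg)
    ultimately show ?thesis by (simp add: measure_def)
  next
    case False
    then obtain i where zero: "u $ i = 0 \<or> v = 0" by auto
    \<comment> \<open>Every coordinate of the constructed vector is strictly positive, so a corner
      with a zero coordinate contains no sample point.\<close>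
    have "indicator {..u} (\<psi>_vec z) * indicator {..v} (\<psi>\<^sub>0 y) = (0::ennreal)" for z y
      using zero \<psi>\<^sub>0_range(1)[of "z $ i"] \<psi>\<^sub>0_range(1)[of y]
      by (auto simp: indicator_def \<psi>_vec_def less_eq_vec_def not_le intro!: exI[of _ i])
    then have "emeasure ?M ({..u} \<times> {..v}) = 0"
      by (subst emeasure_copula_measure) (simp, simp, simp only: mult.assoc mult_zero_right nn_integral_const mult_zero_left)
    then show ?thesis
      using archimedean_function_0[OF zero] C[OF uv] by (simp add: measure_def)
  qed
  with prob sets cube show ?thesis by (simp add: has_distribution_function_def)
qed

subsection \<open>Conditional distributions and supports\<close>

lemma emeasure_marginal_copula_measure:
  assumes [measurable]: "E \<in> sets borel"
  shows "emeasure (marginal (copula_measure :: ((real^'n) \<times> real) measure)) E =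
    (\<integral>\<^sup>+z. indicator {0..} z * emeasure (cond_kernel \<gamma> (\<Sum>i\<in>UNIV. z $ i)) UNIV *
      indicator E (\<psi>_vec z) \<partial>lborel)"
proof -
  have sets: "sets (copula_measure :: ((real^'n) \<times> real) measure) = sets borel"
    by (simp add: copula_measure_def)
  have "(fst :: (real^'n) \<times> real \<Rightarrow> _) \<in> borel_measurable borel"
    by (intro borel_measurable_continuous_onI continuous_intros)
  then have "emeasure (marginal (copula_measure :: ((real^'n) \<times> real) measure)) E =
      emeasure (copula_measure :: ((real^'n) \<times> real) measure) (E \<times> UNIV)"
    unfolding marginal_def using sets sets_eq_imp_space_eq[OF sets]
    by (subst emeasure_distr) (auto simp: measurable_cong_sets[OF sets refl] vimage_fst)
  then show ?thesis
    by (simp add: emeasure_copula_measure_kernel ac_simps)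
qed

lemma cond_kernel_sum_measurable [measurable]:
  assumes "finite_measure \<sigma>" "sets \<sigma> = sets borel" "F \<in> sets borel"
  shows "(\<lambda>z :: real^'n. emeasure (cond_kernel \<sigma> (\<Sum>i\<in>UNIV. z $ i)) F) \<in> borel_measurable borel"
  using assms by measurable

lemma marginal_copula_measure:
  "marginal (copula_measure :: ((real^'n) \<times> real) measure) =
    distr (density lborel (\<lambda>z. indicator {0..} z * emeasure (cond_kernel \<gamma> (\<Sum>i\<in>UNIV. z $ i)) UNIV))
      borel \<psi>_vec"
proof (rule measure_eqI)
  note [measurable] = cond_kernel_sum_measurable[OF \<gamma>.finite_measure_axioms sets_\<gamma>]
  fix E assume "E \<in> sets (marginal (copula_measure :: ((real^'n) \<times> real) measure))"
  then have [measurable]: "E \<in> sets borel" by (simp add: marginal_def)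
  have "emeasure (distr (density lborel (\<lambda>z. indicator {0..} z *
        emeasure (cond_kernel \<gamma> (\<Sum>i\<in>UNIV. z $ i)) UNIV)) borel \<psi>_vec) E =
      (\<integral>\<^sup>+u. indicator E u \<partial>distr (density lborel (\<lambda>z. indicator {0..} z *
        emeasure (cond_kernel \<gamma> (\<Sum>i\<in>UNIV. z $ i)) UNIV)) borel \<psi>_vec)"
    by simp
  also have "\<dots> = emeasure (marginal (copula_measure :: ((real^'n) \<times> real) measure)) E"
    by (subst nn_integral_distr, measurable, subst nn_integral_density, measurable)
      (simp add: emeasure_marginal_copula_measure)
  finally show "emeasure (marginal copula_measure) E = emeasure (distr (density lborel (\<lambda>z. indicator {0..} z *
        emeasure (cond_kernel \<gamma> (\<Sum>i\<in>UNIV. z $ i)) UNIV)) borel \<psi>_vec) E" by simp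
qed (simp add: marginal_def)

lemma nn_integral_marginal_copula_measure:
  assumes [measurable]: "f \<in> borel_measurable borel"
  shows "(\<integral>\<^sup>+u. f u \<partial>marginal (copula_measure :: ((real^'n) \<times> real) measure)) =
    (\<integral>\<^sup>+z. indicator {0..} z * emeasure (cond_kernel \<gamma> (\<Sum>i\<in>UNIV. z $ i)) UNIV * f (\<psi>_vec z) \<partial>lborel)"
proof -
  note [measurable] = cond_kernel_sum_measurable[OF \<gamma>.finite_measure_axioms sets_\<gamma>]
  show ?thesis
    unfolding marginal_copula_measure
    by (subst nn_integral_distr, measurable, subst nn_integral_density, measurable)
qed

text \<open>The marginal is the image of a measure with a Lebesgue density, so the origin can be
  discarded. All remaining points of the orthant have positive coordinate sum.\<close>

lemma AE_marginal_copula_measure: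
  assumes "\<And>z :: real^'n. 0 \<le> z \<Longrightarrow> z \<noteq> 0 \<Longrightarrow> P (\<psi>_vec z)" and P: "{u. P u} \<in> sets borel"
  shows "AE u in marginal (copula_measure :: ((real^'n) \<times> real) measure). P u"
proof -
  note [measurable] = cond_kernel_sum_measurable[OF \<gamma>.finite_measure_axioms sets_\<gamma>]
  have "AE z in (lborel :: (real^'n) measure). 0 \<le> z \<longrightarrow> P (\<psi>_vec z)"
    using AE_lborel_singleton[of 0] by eventually_elim (use assms(1) in auto)
  then show ?thesis
    unfolding marginal_copula_measure
    by (subst AE_distr_iff) (use P in \<open>auto simp: AE_density indicator_def elim!: eventually_mono\<close>)
qed

lemma AE_\<phi>_sum_pos:
  "AE u in marginal (copula_measure :: ((real^'n) \<times> real) measure). u \<in> {0..1} \<and> 0 < \<phi>_sum u"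
proof (rule AE_marginal_copula_measure)
  have "{u. u \<in> {0..1} \<and> 0 < \<phi>_sum u} = {0..1} \<inter> {u \<in> space borel. 0 < \<phi>_sum (u :: real^'n)}" by auto
  also have "\<dots> \<in> sets borel"
    by (intro sets.Int borel_measurable_less) auto
  finally show "{u :: real^'n. u \<in> {0..1} \<and> 0 < \<phi>_sum u} \<in> sets borel" .
qed (simp add: \<phi>_sum_\<psi>_vec sum_vec_pos)

text \<open>K is a kernel on the cube only; the indicator extends it by 0 to the whole
  space.\<close>

lemma conditional_distribution_measurable:
  assumes "regular_conditional_distribution \<mu> K" "F \<in> sets borel"
  shows "(\<lambda>u :: real^'n. emeasure (K u) F * indicator {0..1} u) \<in> borel_measurable borel"
proof -
  have "K \<in> restrict_space borel {0..1} \<rightarrow>\<^sub>M subprob_algebra borel"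
    using assms(1) by (intro measurable_prob_algebraD) (simp add: regular_conditional_distribution_def)
  then have "(\<lambda>u. emeasure (K u) F) \<in> borel_measurable (restrict_space borel {0..1})"
    using assms(2) by (rule measurable_compose[OF _ measurable_emeasure_subprob_algebra])
  then show ?thesis
    by (subst (asm) borel_measurable_restrict_space_iff_ennreal) auto
qed

text \<open>Both sides are densities, with respect to the marginal, of the finite measure that sends
  A to the copula mass of A \<times> F; such densities are unique almost everywhere.\<close>

lemma AE_conditional_distribution_eq:
  assumes prob: "prob_space (copula_measure :: ((real^'n) \<times> real) measure)"
    and K: "regular_conditional_distribution (copula_measure :: ((real^'n) \<times> real) measure) K"
    and F: "F \<in> sets borel" "F \<subseteq> {0..1}"
  shows "AE u in marginal (copula_measure :: ((real^'n) \<times> real) measure).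
    emeasure (K u) F * indicator {0..1} u =
    inverse (emeasure (cond_kernel \<gamma> (\<phi>_sum u)) UNIV) * emeasure (cond_kernel \<gamma> (\<phi>_sum u)) F"
    (is "AE u in ?\<nu>. ?f u = ?f' u")
proof -
  note [measurable] = F(1)
  have [measurable]: "(\<lambda>u :: real^'n. emeasure (cond_kernel \<gamma> (\<phi>_sum u)) F) \<in> borel_measurable borel"
    if "F \<in> sets borel" for F
    using that by (intro cond_kernel_measurable \<gamma>.finite_measure_axioms) auto
  have fst: "fst \<in> (copula_measure :: ((real^'n) \<times> real) measure) \<rightarrow>\<^sub>M borel"
    unfolding copula_measure_def measurable_distr_eq1
    by (intro borel_measurable_continuous_onI continuous_intros)
  interpret \<nu>: prob_space ?\<nu>
    unfolding marginal_def by (rule prob_space.prob_space_distr[OF prob fst])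
  have sets [measurable_cong, simp]: "sets ?\<nu> = sets borel" by (simp add: marginal_def)
  have f [measurable]: "?f \<in> borel_measurable borel"
    by (rule conditional_distribution_measurable[OF K F(1)])
  show ?thesis
  proof (rule \<nu>.density_unique_finite_measure)
    fix A assume "A \<in> sets ?\<nu>"
    then have A [measurable]: "A \<in> sets borel" by simp
    have "(\<integral>\<^sup>+u. ?f u * indicator A u \<partial>?\<nu>) = (\<integral>\<^sup>+u\<in>A \<inter> {0..1}. emeasure (K u) F \<partial>?\<nu>)"
      by (intro nn_integral_cong) (auto simp: indicator_def)
    also have "\<dots> = emeasure (copula_measure :: ((real^'n) \<times> real) measure) ((A \<inter> {0..1}) \<times> F)"
      using K A F by (simp add: regular_conditional_distribution_def kernel_composition_def sets.Int)
    also have "\<dots> = (\<integral>\<^sup>+z. indicator {0..} z * indicator (A \<inter> {0..1}) (\<psi>_vec z) *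
        emeasure (cond_kernel \<gamma> (\<Sum>i\<in>UNIV. z $ i)) F \<partial>lborel)"
      by (rule emeasure_copula_measure_kernel) auto
    also have "\<dots> = (\<integral>\<^sup>+z. indicator {0..} z * emeasure (cond_kernel \<gamma> (\<Sum>i\<in>UNIV. z $ i)) UNIV *
        (?f' (\<psi>_vec z) * indicator A (\<psi>_vec z)) \<partial>lborel)"
    proof (rule nn_integral_cong_AE)
      show "AE z in lborel. indicator {0..} z * indicator (A \<inter> {0..1}) (\<psi>_vec z) *
          emeasure (cond_kernel \<gamma> (\<Sum>i\<in>UNIV. z $ i)) F =
        indicator {0..} z * emeasure (cond_kernel \<gamma> (\<Sum>i\<in>UNIV. z $ i)) UNIV *
          (?f' (\<psi>_vec z) * indicator A (\<psi>_vec z))"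
        using AE_lborel_singleton[of "0 :: real^'n"]
      proof eventually_elim
        case (elim z)
        show ?case
        proof (cases "0 \<le> z")
          case True
          let ?h = "emeasure (cond_kernel \<gamma> (\<Sum>i\<in>UNIV. z $ i)) UNIV"
          have pos: "0 < (\<Sum>i\<in>UNIV. z $ i)" using True elim by (rule sum_vec_pos)
          have h: "0 < ?h" "?h < \<infinity>"
            by (rule cond_kernel_mass_pos[OF pos], rule cond_kernel_mass_finite[OF pos])
          \<comment> \<open>In the extended reals this cancellation needs both 0 < h and h <
            \<infinity>.\<close>
          then have "?h * inverse ?h = 1"
            by (simp add: ennreal_divide_self flip: divide_ennreal_def)
          then have "?h * (inverse ?h * x) = x" for x by (metis mult.assoc mult_1)
          then show ?thesis
            using True by (simp add: \<phi>_sum_\<psi>_vec[OF True] indicator_def)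
        qed simp
      qed
    qed
    also have "\<dots> = (\<integral>\<^sup>+u. ?f' u * indicator A u \<partial>?\<nu>)"
      by (rule nn_integral_marginal_copula_measure[symmetric]) measurable
    finally show "(\<integral>\<^sup>+u. ?f u * indicator A u \<partial>?\<nu>) = (\<integral>\<^sup>+u. ?f' u * indicator A u \<partial>?\<nu>)" .
  qed (use f in auto)
qed

text \<open>The exceptional set for a single F depends on F, so only the countably many intervals
  with rational endpoint are compared. Capping the endpoint at 1 keeps F inside [0, 1], and neither
  measure charges the complement.\<close>

lemma AE_conditional_distribution:
  assumes prob: "prob_space (copula_measure :: ((real^'n) \<times> real) measure)"
    and K: "regular_conditional_distribution (copula_measure :: ((real^'n) \<times> real) measure) K"
  shows "AE u in marginal (copula_measure :: ((real^'n) \<times> real) measure).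
    K u = scale_measure (inverse (emeasure (cond_kernel \<gamma> (\<phi>_sum u)) UNIV)) (cond_kernel \<gamma> (\<phi>_sum u))"
proof -
  have "AE u in marginal (copula_measure :: ((real^'n) \<times> real) measure). \<forall>q\<in>\<rat>.
      emeasure (K u) {0..min 1 q} * indicator {0..1} u =
      inverse (emeasure (cond_kernel \<gamma> (\<phi>_sum u)) UNIV) * emeasure (cond_kernel \<gamma> (\<phi>_sum u)) {0..min 1 q}"
    by (intro AE_ball_countable' AE_conditional_distribution_eq[OF prob K] countable_rat) auto
  then show ?thesis
    using AE_\<phi>_sum_pos
  proof eventually_elim
    case (elim u)
    let ?h = "emeasure (cond_kernel \<gamma> (\<phi>_sum u)) UNIV"
    have u: "u \<in> {0..1}" and pos: "0 < \<phi>_sum u" using elim by auto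
    have "K u \<in> space (prob_algebra borel)"
      using K u by (auto simp: regular_conditional_distribution_def space_restrict_space
          dest!: measurable_space[of K _ _ u])
    then have prob_K: "prob_space (K u)" and sets_K: "sets (K u) = sets borel"
      by (auto simp: space_prob_algebra)
    have "emeasure (K u) (- {0..1}) = 0"
      using K u by (auto simp: regular_conditional_distribution_def)
    then have null_K: "- {0..1} \<in> null_sets (K u)" by (auto simp: null_sets_def sets_K)
    have "emeasure (cond_kernel \<gamma> (\<phi>_sum u)) (- {0..1}) = 0"
      by (rule cond_kernel_eq_0[of \<gamma> _ "{}"]) (use \<psi>\<^sub>0_range in \<open>auto simp: less_imp_le\<close>)
    then have null_kernel: "- {0..1} \<in> null_sets (cond_kernel \<gamma> (\<phi>_sum u))"
      by (auto simp: null_sets_def)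
    have cut: "emeasure L {..q} = emeasure L {0..min 1 q}"
      if "sets L = sets borel" "- {0..1} \<in> null_sets L" for L :: "real measure" and q
    proof (rule emeasure_eq_AE)
      show "AE x in L. x \<in> {..q} \<longleftrightarrow> x \<in> {0..min 1 q}"
        using AE_not_in[OF that(2)] by eventually_elim auto
    qed (simp_all add: that(1))
    show ?case
    proof (rule measure_eqI_rat_atMost)
      show "finite_measure (K u)"
        using prob_K by (rule prob_space.finite_measure)
      fix q :: real assume "q \<in> \<rat>"
      then show "emeasure (K u) {..q} = emeasure (scale_measure (inverse ?h) (cond_kernel \<gamma> (\<phi>_sum u))) {..q}"
        using elim(1) u by (simp add: cut[OF sets_K null_K] cut[OF sets_cond_kernel null_kernel])
    qed (simp_all add: sets_K)
  qed
qed

text \<open>A null open set meeting the cube would contain a null open rectangle E \<times> F in the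
  interior. Positivity of the kernel on F makes E null for the marginal, whose Lebesgue density is
  positive away from the origin; hence a nonempty open preimage of E would be Lebesgue null.\<close>

lemma full_support_kernel_composition:
  assumes \<sigma>: "finite_measure \<sigma>" "sets \<sigma> = sets borel" "measure_support \<sigma> = {0..}"
    and L: "AE u in marginal (copula_measure :: ((real^'n) \<times> real) measure). \<forall>F \<in> sets borel.
      emeasure (L u) F = inverse (emeasure (cond_kernel \<gamma> (\<phi>_sum u)) UNIV) *
        emeasure (cond_kernel \<sigma> (\<phi>_sum u)) F"
    and M: "kernel_composition (marginal (copula_measure :: ((real^'n) \<times> real) measure)) L M"
  shows "measure_support M = unit_cube"
proof
  let ?\<nu> = "marginal (copula_measure :: ((real^'n) \<times> real) measure)"
  have null: "emeasure M (- unit_cube) = 0" and sets_M: "sets M = sets borel"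
    and rect: "\<And>E F. E \<in> sets borel \<Longrightarrow> F \<in> sets borel \<Longrightarrow> E \<subseteq> {0..1} \<Longrightarrow> F \<subseteq> {0..1} \<Longrightarrow>
        emeasure M (E \<times> F) = (\<integral>\<^sup>+u\<in>E. emeasure (L u) F \<partial>?\<nu>)"
    using M by (auto simp: kernel_composition_def)
  show "measure_support M \<subseteq> unit_cube"
    using null closed_unit_cube unfolding measure_support_def by (auto simp: open_Compl)
  show "unit_cube \<subseteq> measure_support M"
  proof (rule subsetI, rule ccontr)
    fix p :: "(real^'n) \<times> real" assume p: "p \<in> unit_cube" "p \<notin> measure_support M"
    then obtain U where U: "open U" "p \<in> U" "emeasure M U = 0"
      by (auto simp: measure_support_def)
    obtain A B where AB: "open A" "open B" "p \<in> A \<times> B" "A \<times> B \<subseteq> U"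
      using open_prod_elim[OF U(1,2)] by blast
    \<comment> \<open>The point p may lie on the boundary, but the cube is the closure of its
      interior, so the neighbourhood can be shrunk to interior points, where \<open>\<phi>\<close>
      is positive.\<close>
    define E where "E = A \<inter> box 0 1"
    define F where "F = B \<inter> {0<..<1}"
    have E: "open E" "E \<noteq> {}" "E \<subseteq> {0..1}"
    proof -
      have "(\<chi> i. 1 / 2) \<in> (box 0 1 :: (real^'n) set)" by (simp add: mem_box_cart)
      then have "closure (box 0 1 :: (real^'n) set) = {0..1}"
        unfolding interval_cbox_cart by (intro closure_box) auto
      then have "fst p \<in> closure (box 0 1)"
        using p(1) by (auto simp: unit_cube_def)
      then show "E \<noteq> {}"
        using AB open_Int_closure_eq_empty[of A "box 0 1"] unfolding E_def by auto
      show "open E" using AB by (auto simp: E_def open_box)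
      show "E \<subseteq> {0..1}" unfolding E_def interval_cbox_cart using box_subset_cbox by auto
    qed
    have F: "open F" "F \<noteq> {}" "F \<subseteq> {0<..<1}"
    proof -
      have "snd p \<in> closure {0<..<1}" using p(1) by (auto simp: unit_cube_def)
      then show "F \<noteq> {}"
        using AB open_Int_closure_eq_empty[of B "{0<..<1}"] unfolding F_def by auto
    qed (use AB in \<open>auto simp: F_def\<close>)
    have EF_borel [measurable]: "E \<in> sets borel" "F \<in> sets borel" using E F by auto
    have meas [measurable]: "(\<lambda>u :: real^'n. emeasure (cond_kernel \<tau> (\<phi>_sum u)) X) \<in> borel_measurable borel"
      if "finite_measure \<tau>" "sets \<tau> = sets borel" "X \<in> sets borel" for \<tau> X
      using that by (intro cond_kernel_measurable) auto
    have sets_\<nu> [measurable_cong, simp]: "sets ?\<nu> = sets borel" by (simp add: marginal_def)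
    have "emeasure M (E \<times> F) \<le> emeasure M U"
      using AB U(1) by (intro emeasure_mono) (auto simp: E_def F_def sets_M)
    moreover have "F \<subseteq> {0..1}" using F(3) by auto
    ultimately have "(\<integral>\<^sup>+u\<in>E. emeasure (L u) F \<partial>?\<nu>) = 0"
      using U(3) rect[OF EF_borel E(3)] by simp
    \<comment> \<open>L carries no measurability information. The explicit integrand is measurable,
      so its vanishing integral can be read as vanishing almost everywhere.\<close>
    also have "(\<integral>\<^sup>+u\<in>E. emeasure (L u) F \<partial>?\<nu>) =
        (\<integral>\<^sup>+u\<in>E. inverse (emeasure (cond_kernel \<gamma> (\<phi>_sum u)) UNIV) *
          emeasure (cond_kernel \<sigma> (\<phi>_sum u)) F \<partial>?\<nu>)"
      using L by (intro nn_integral_cong_AE) (auto elim!: eventually_mono)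
    finally have "AE u in ?\<nu>. inverse (emeasure (cond_kernel \<gamma> (\<phi>_sum u)) UNIV) *
          emeasure (cond_kernel \<sigma> (\<phi>_sum u)) F * indicator E u = 0"
      using meas[OF \<gamma>.finite_measure_axioms sets_\<gamma>, of UNIV] meas[OF \<sigma>(1,2) EF_borel(2)]
      by (subst (asm) nn_integral_0_iff_AE) auto
    then have "AE u in ?\<nu>. u \<notin> E"
      using AE_\<phi>_sum_pos
    proof eventually_elim
      case (elim u)
      have "0 < emeasure (cond_kernel \<sigma> (\<phi>_sum u)) F"
        using elim F by (intro cond_kernel_pos \<sigma>) auto
      \<comment> \<open>Finite mass keeps the normalising factor, an extended inverse, from being
        0.\<close>
      moreover have "emeasure (cond_kernel \<gamma> (\<phi>_sum u)) UNIV \<noteq> \<infinity>"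
        using cond_kernel_mass_finite[of "\<phi>_sum u" UNIV] elim by auto
      ultimately show ?case
        using elim by (auto simp: indicator_def split: if_splits)
    qed
    then have "emeasure ?\<nu> E = 0"
      by (subst (asm) AE_iff_measurable[of E]) (auto simp: marginal_def)
    then have "(\<integral>\<^sup>+z. indicator {0..} z * emeasure (cond_kernel \<gamma> (\<Sum>i\<in>UNIV. z $ i)) UNIV *
        indicator E (\<psi>_vec z) \<partial>lborel) = 0"
      by (simp add: emeasure_marginal_copula_measure)
    then have AE_E: "AE z in lborel. indicator {0..} z * emeasure (cond_kernel \<gamma> (\<Sum>i\<in>UNIV. z $ i)) UNIV *
        indicator E (\<psi>_vec z) = 0"
      using cond_kernel_sum_measurable[OF \<gamma>.finite_measure_axioms sets_\<gamma>, of UNIV]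
      by (subst (asm) nn_integral_0_iff_AE) auto
    define W where "W = \<psi>_vec -` E \<inter> {z :: real^'n. \<forall>i. 0 < z $ i}"
    have "{z :: real^'n. \<forall>i. 0 < z $ i} = (\<Inter>i. {z. 0 < z $ i})" by auto
    also have "open \<dots>" by (intro open_INT ballI open_Collect_less continuous_intros) simp
    finally have "open W" unfolding W_def
      by (intro open_Int open_vimage E continuous_on_\<psi>_vec)
    have "AE z in lborel. z \<notin> W"
      using AE_E AE_lborel_singleton[of "0 :: real^'n"]
    proof eventually_elim
      case (elim z)
      show ?case
      proof
        assume "z \<in> W"
        then have z: "0 \<le> z" "\<psi>_vec z \<in> E" by (auto simp: W_def less_eq_vec_def less_imp_le)
        then have "0 < emeasure (cond_kernel \<gamma> (\<Sum>i\<in>UNIV. z $ i)) UNIV"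
          using elim(2) by (intro cond_kernel_mass_pos sum_vec_pos)
        then show False using elim(1) z by simp
      qed
    qed
    then have "emeasure lborel W = 0"
      using \<open>open W\<close> by (subst (asm) AE_iff_measurable[of W]) auto
    then have "negligible W"
      using \<open>open W\<close> by (simp add: negligible_iff_null_sets null_sets_completionI null_sets_def)
    moreover have "W \<noteq> {}"
    proof -
      obtain u where u: "u \<in> E" using E(2) by auto
      then have u_bounds: "0 < u $ i" "u $ i < 1" for i
        by (auto simp: E_def mem_box_cart)
      have "0 < \<phi> (u $ i)" for i using u_bounds by (rule \<phi>_pos)
      moreover have "\<psi>_vec (\<chi> i. \<phi> (u $ i)) = u"
        using u_bounds by (simp add: \<psi>_vec_def vec_eq_iff less_imp_le)
      ultimately have "(\<chi> i. \<phi> (u $ i)) \<in> W" using u by (simp add: W_def)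
      then show ?thesis by auto
    qed
    ultimately show False using open_not_negligible[OF \<open>open W\<close>] by blast
  qed
qed

end

theorem theorem3p14:
  fixes d :: nat
    and C :: "(real^'n) \<times> real \<Rightarrow> real"
    and \<gamma> \<gamma>abs \<gamma>dis \<gamma>sing :: "real measure"
    and \<mu> \<mu>abs \<mu>dis \<mu>sing :: "((real^'n) \<times> real) measure"
    and K Kabs Kdis Ksing :: "real^'n \<Rightarrow> real measure"
  assumes "d \<ge> 2" and "CARD('n) = d - 1"
    and "C \<in> archimedean_copulas"
    and "is_williamson_measure_of d \<gamma> C"
    and "lebesgue_decomposition \<gamma> \<gamma>abs \<gamma>dis \<gamma>sing"
    and "has_distribution_function \<mu> C"
    and "regular_conditional_distribution \<mu> K"
    and "\<And>x. x \<in> {0..1} \<Longrightarrow> lebesgue_decomposition (K x) (Kabs x) (Kdis x) (Ksing x)"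
    and "kernel_composition (marginal \<mu>) Kabs \<mu>abs"
    and "kernel_composition (marginal \<mu>) Kdis \<mu>dis"
    and "kernel_composition (marginal \<mu>) Ksing \<mu>sing"
  shows "(measure_support \<gamma>abs = {0..} \<longrightarrow> measure_support \<mu>abs = unit_cube) \<and>
         (measure_support \<gamma>dis = {0..} \<longrightarrow> measure_support \<mu>dis = unit_cube) \<and>
         (measure_support \<gamma>sing = {0..} \<longrightarrow> measure_support \<mu>sing = unit_cube)"
proof -
  obtain \<psi> where gen: "generates \<psi> C" and \<psi>: "\<And>z. 0 \<le> z \<Longrightarrow> \<psi> z = williamson_transform d \<gamma> z"
    and \<gamma>: "\<gamma> \<in> williamson_measures d"
    using assms(4) by (auto simp: is_williamson_measure_of_def)
  have parts: "finite_measure \<sigma>" "sets \<sigma> = sets borel" "\<And>X. X \<in> sets borel \<Longrightarrow> emeasure \<sigma> X \<le> emeasure \<gamma> X"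
    if "\<sigma> \<in> {\<gamma>abs, \<gamma>dis, \<gamma>sing}" for \<sigma>
    using assms(5) that by (auto simp: lebesgue_decomposition_def intro: add_increasing add_increasing2)
  \<comment> \<open>Full support of whichever part is considered passes to \<open>\<gamma>\<close>
    by domination near 0.\<close>
  have generator: "positive_williamson_generator (d - 1) \<gamma> \<psi>"
    if \<sigma>: "\<sigma> \<in> {\<gamma>abs, \<gamma>dis, \<gamma>sing}" and supp: "measure_support \<sigma> = {0..}" for \<sigma>
  proof (rule positive_williamson_generator.intro)
    show "0 < d - 1" using assms(1) by simp
    show "prob_space \<gamma>" and sets: "sets \<gamma> = sets borel"
      using \<gamma> by (auto simp: williamson_measures_def)
    have "{..<0} \<in> null_sets \<gamma>" "{0} \<in> null_sets \<gamma>"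
      using \<gamma> by (auto simp: williamson_measures_def null_sets_def)
    then have "{..<0} \<union> {0} \<in> null_sets \<gamma>" by (rule null_sets.Un)
    moreover have "{..<0} \<union> {0} = {..0 :: real}" by auto
    ultimately show "emeasure \<gamma> {..0} = 0" by auto
    show "0 < emeasure \<gamma> {0<..<e}" if "0 < e" for e :: real
    proof -
      have "e / 2 \<in> {0<..<e} \<inter> {0..}" using that by simp
      then have "{0<..<e} \<inter> {0..} \<noteq> {}" by blast
      then have "0 < emeasure \<sigma> {0<..<e}"
        by (intro measure_support_emeasure_pos[OF supp]) simp_all
      also have "\<dots> \<le> emeasure \<gamma> {0<..<e}" by (rule parts(3)[OF \<sigma>]) simp
      finally show ?thesis .
    qed
    show "\<psi> z = (LINT t:{0..}|\<gamma>. (max 0 (1 - t * z)) ^ (d - 1))" if "0 \<le> z" for z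
      using \<psi>[OF that] by (simp add: williamson_transform_def)
    show "continuous_on {0..} \<psi>" "\<psi> 0 = 1" "(\<psi> \<longlongrightarrow> 0) at_top"
      using gen by (auto simp: generates_def normalized_generator_def)
  qed
  \<comment> \<open>The part, its kernel and its measure range over three matching triples, so one
    argument serves all three claims.\<close>
  have conclusion:
    "measure_support \<mu>\<sigma> = unit_cube"
    if \<sigma>: "(\<sigma>, K\<sigma>, \<mu>\<sigma>) \<in> {(\<gamma>abs, Kabs, \<mu>abs), (\<gamma>dis, Kdis, \<mu>dis), (\<gamma>sing, Ksing, \<mu>sing)}"
      and supp: "measure_support \<sigma> = {0..}" for \<sigma> K\<sigma> \<mu>\<sigma>
  proof -
    have part: "\<sigma> \<in> {\<gamma>abs, \<gamma>dis, \<gamma>sing}" using \<sigma> by auto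
    interpret positive_williamson_generator "d - 1" \<gamma> \<psi> by (rule generator[OF part supp])
    have "has_distribution_function (copula_measure :: ((real^'n) \<times> real) measure) C"
      using gen assms(2) by (intro copula_measure_has_distribution_function) (auto simp: generates_def)
    then have \<mu>: "\<mu> = copula_measure" and prob: "prob_space (copula_measure :: ((real^'n) \<times> real) measure)"
      using has_distribution_function_unique[OF assms(6)] by (auto simp: has_distribution_function_def)
    show ?thesis
    proof (rule full_support_kernel_composition[OF parts(1,2)[OF part] supp])
      show "kernel_composition (marginal copula_measure) K\<sigma> \<mu>\<sigma>"
        using \<sigma> assms(9-11) unfolding \<mu> by auto
      show "AE u in marginal copula_measure. \<forall>F\<in>sets borel. emeasure (K\<sigma> u) F =
          inverse (emeasure (cond_kernel \<gamma> (\<phi>_sum u)) UNIV) * emeasure (cond_kernel \<sigma> (\<phi>_sum u)) F"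
        using AE_conditional_distribution[OF prob assms(7)[unfolded \<mu>]] AE_\<phi>_sum_pos
      proof eventually_elim
        case (elim u)
        let ?r = "inverse (emeasure (cond_kernel \<gamma> (\<phi>_sum u)) UNIV)"
        have u: "u \<in> {0..1}" "0 < \<phi>_sum u" using elim(2) by auto
        have "?r < \<infinity>"
          using cond_kernel_mass_pos[OF u(2)] by (simp add: less_top[symmetric])
        then have "lebesgue_decomposition (scale_measure ?r (cond_kernel \<gamma> (\<phi>_sum u)))
            (scale_measure ?r (cond_kernel \<gamma>abs (\<phi>_sum u))) (scale_measure ?r (cond_kernel \<gamma>dis (\<phi>_sum u)))
            (scale_measure ?r (cond_kernel \<gamma>sing (\<phi>_sum u)))"
          by (intro lebesgue_decomposition_scale_measure lebesgue_decomposition_cond_kernel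
              assms(5) u sets_cond_kernel)
        \<comment> \<open>For almost every u the given decomposition and the transported one
          decompose the same measure \<open>K u\<close>.\<close>
        from lebesgue_decomposition_unique[OF assms(8)[OF u(1), unfolded elim(1)] this]
        show ?case using \<sigma> by auto
      qed
    qed
  qed
  show ?thesis using conclusion by blast
qed

end
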